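(* Let $\Omega$ be a finite set with $n=|\Omega|$ elements and let $G\leq S_\Omega$ be a group of permutations of $\Omega$. Let $X=\{(i,R) : i\in R\subseteq\Omega\}$ and $\chi=\{R : \emptyset\neq R\subseteq\Omega\}$, with $G$ acting on $X$ by $g\cdot(i,R)=(g(i),g(R))$ and on $\chi$ by $g\cdot R=g(R)$. Let $\mathcal{A}_G$ be the affine space of all $G$-symmetric quasi-values on $\Omega$. Then $$\dim \mathcal{A}_G=|X/G|-|\chi/G|,$$ where $X/G$ and $\chi/G$ denote the sets of $G$-orbits. Explicitly, the dimension is also given by $$\dim\mathcal{A}_G=\left(\frac{\partial Z_G}{\partial x_1}-Z_G\right)\Big|_{(x_1,\ldots,x_n)=(2,2,\ldots,2)}+1,$$ where $Z_G$ is the cycle index of $G$, $$Z_G(x_1,\ldots,x_n)=\frac{1}{|G|}\sum_{\pi\in G}x_1^{j_1(\pi)}\cdots x_n^{j_n(\pi)},$$ and $j_k(\pi)$ denotes the number of cycles of length $k$ of the permutation $\pi$ of $\Omega$ (fixed points being cycles of length $1$).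
   Context: Let $\Omega$ be a finite set (of players). A cooperative game is a function $v:2^\Omega\to\mathbb{R}$ with $v(\emptyset)=0$; it is additive if $v(R\cup T)=v(R)+v(T)$ whenever $R\cap T=\emptyset$. Let $\Gamma$ be the real vector space of all cooperative games and $\Gamma_1$ the subspace of additive ones. A game value is a map $\varphi:\Gamma\to\Gamma_1$; put $\varphi_i(v):=\varphi(v)(\{i\})$ for $i\in\Omega$. A permutation $\pi$ of $\Omega$ acts on games by $(\pi\cdot v)(R)=v(\pi^{-1}(R))$. A quasi-value is a game value $\varphi$ satisfying: (1) Linearity: $\varphi(\alpha v+\beta w)=\alpha\varphi(v)+\beta\varphi(w)$ for all $v,w\in\Gamma$, $\alpha,\beta\in\mathbb{R}$; (2) Null-player property: if $v(R\cup\{i\})=v(R)$ for every $R\subseteq\Omega$, then $\varphi_i(v)=0$; (3) Efficiency: $\sum_{i\in\Omega}\varphi_i(v)=v(\Omega)$ for all $v\in\Gamma$. For a group $G$ of permutations of $\Omega$, a $G$-symmetric quasi-value is a quasi-value $\varphi$ such that $\varphi(\pi\cdot v)=\pi\cdot\varphi(v)$ for all $\pi\in G$ and all $v\in\Gamma$. The set $\mathcal{A}_G$ of all $G$-symmetric quasi-values is a nonempty affine subspace of the vector space of linear maps $\Gamma\to\Gamma_1$, and $\dim\mathcal{A}_G$ is its dimension as a real affine space. *)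

theory Defs
  imports
    "HOL-Analysis.Analysis"
    "HOL-Library.Function_Algebras"
    "HOL-Algebra.Group_Action"
    "HOL-Combinatorics.Permutations"
    "HOL-Combinatorics.Orbits"
begin

section \<open>Function spaces as real vector spaces\<close>

instantiation "fun" :: (type, real_vector) real_vector
begin

definition scaleR_fun :: "real \<Rightarrow> ('a \<Rightarrow> 'b) \<Rightarrow> 'a \<Rightarrow> 'b"
  where "scaleR_fun c f = (\<lambda>x. c *\<^sub>R f x)"

instance
  by standard (auto simp: scaleR_fun_def fun_eq_iff scaleR_add_right scaleR_add_left)

end

text \<open>
  The library's \<open>aff_dim\<close> is restricted to Euclidean spaces. The same notion for an arbitrary
  real vector space has to ask for a finite affine basis, since \<open>card\<close> is \<open>0\<close> on infinite sets.
\<close>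

definition affine_dim :: "'v::real_vector set \<Rightarrow> int"
  where "affine_dim A =
    (SOME d :: int. \<exists>B. finite B \<and> affine hull B = affine hull A \<and> \<not> affine_dependent B
      \<and> of_nat (card B) = d + 1)"

lemma affine_dim_eq_aff_dim: "affine_dim A = aff_dim (A :: 'v::euclidean_space set)"
proof -
  have "finite B" if "\<not> affine_dependent B" for B :: "'v set"
    using that aff_independent_finite by blast
  then have "(\<lambda>d :: int. \<exists>B. finite B \<and> affine hull B = affine hull A \<and> \<not> affine_dependent B
      \<and> of_nat (card B) = d + 1) =
    (\<lambda>d. \<exists>B. affine hull B = affine hull A \<and> \<not> affine_dependent B \<and> of_nat (card B) = d + 1)"
    by blast
  then show ?thesis
    unfolding affine_dim_def aff_dim_def by simp
qed


section \<open>Cooperative games and quasi-values\<close>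

text \<open>
  The player set \<open>\<Omega>\<close> is a set of elements of an arbitrary type. A function on the subsets of \<open>\<Omega>\<close>
  is represented by its extension by \<open>0\<close> to all sets, and likewise a map on games by its extension
  by \<open>0\<close> to all functions. Thus functions agreeing on the relevant domain are equal, and the
  vector space operations are the pointwise ones.
\<close>

type_synonym 'a game = "'a set \<Rightarrow> real"

definition games :: "'a set \<Rightarrow> 'a game set"
  where "games \<Omega> = {v. v {} = 0 \<and> (\<forall>R. \<not> R \<subseteq> \<Omega> \<longrightarrow> v R = 0)}"

definition additive_games :: "'a set \<Rightarrow> 'a game set"
  where "additive_games \<Omega> =
    {v \<in> games \<Omega>. \<forall>R T. R \<subseteq> \<Omega> \<longrightarrow> T \<subseteq> \<Omega> \<longrightarrow> R \<inter> T = {} \<longrightarrow> v (R \<union> T) = v R + v T}"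

definition game_values :: "'a set \<Rightarrow> ('a game \<Rightarrow> 'a game) set"
  where "game_values \<Omega> =
    {\<phi>. (\<forall>v \<in> games \<Omega>. \<phi> v \<in> additive_games \<Omega>) \<and> (\<forall>v. v \<notin> games \<Omega> \<longrightarrow> \<phi> v = 0)}"

definition linear_value :: "'a set \<Rightarrow> ('a game \<Rightarrow> 'a game) \<Rightarrow> bool"
  where "linear_value \<Omega> \<phi> \<longleftrightarrow>
    (\<forall>v \<in> games \<Omega>. \<forall>w \<in> games \<Omega>. \<forall>\<alpha> \<beta> :: real.
      \<phi> (\<alpha> *\<^sub>R v + \<beta> *\<^sub>R w) = \<alpha> *\<^sub>R \<phi> v + \<beta> *\<^sub>R \<phi> w)"

definition null_player :: "'a set \<Rightarrow> ('a game \<Rightarrow> 'a game) \<Rightarrow> bool"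
  where "null_player \<Omega> \<phi> \<longleftrightarrow>
    (\<forall>v \<in> games \<Omega>. \<forall>i \<in> \<Omega>. (\<forall>R. R \<subseteq> \<Omega> \<longrightarrow> v (R \<union> {i}) = v R) \<longrightarrow> \<phi> v {i} = 0)"

definition efficient :: "'a set \<Rightarrow> ('a game \<Rightarrow> 'a game) \<Rightarrow> bool"
  where "efficient \<Omega> \<phi> \<longleftrightarrow> (\<forall>v \<in> games \<Omega>. (\<Sum>i\<in>\<Omega>. \<phi> v {i}) = v \<Omega>)"

definition quasi_values :: "'a set \<Rightarrow> ('a game \<Rightarrow> 'a game) set"
  where "quasi_values \<Omega> =
    {\<phi> \<in> game_values \<Omega>. linear_value \<Omega> \<phi> \<and> null_player \<Omega> \<phi> \<and> efficient \<Omega> \<phi>}"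


section \<open>Permutation groups\<close>

definition sym_grp :: "'a set \<Rightarrow> ('a \<Rightarrow> 'a) monoid"
  where "sym_grp \<Omega> = \<lparr>carrier = {\<pi>. \<pi> permutes \<Omega>}, mult = (\<circ>), one = id\<rparr>"

definition permute_game :: "('a \<Rightarrow> 'a) \<Rightarrow> 'a game \<Rightarrow> 'a game"
  where "permute_game \<pi> v = (\<lambda>R. v (Hilbert_Choice.inv \<pi> ` R))"

definition symmetric_quasi_values :: "'a set \<Rightarrow> ('a \<Rightarrow> 'a) set \<Rightarrow> ('a game \<Rightarrow> 'a game) set"
  where "symmetric_quasi_values \<Omega> G =
    {\<phi> \<in> quasi_values \<Omega>.
      \<forall>\<pi> \<in> G. \<forall>v \<in> games \<Omega>. \<phi> (permute_game \<pi> v) = permute_game \<pi> (\<phi> v)}"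

definition pointed_coalitions :: "'a set \<Rightarrow> ('a \<times> 'a set) set"
  where "pointed_coalitions \<Omega> = {(i, R). i \<in> R \<and> R \<subseteq> \<Omega>}"

definition coalitions :: "'a set \<Rightarrow> 'a set set"
  where "coalitions \<Omega> = {R. R \<noteq> {} \<and> R \<subseteq> \<Omega>}"

text \<open>The restrictions make these actions in the sense of the locale \<open>group_action\<close>.\<close>

definition pointed_coalition_orbits :: "'a set \<Rightarrow> ('a \<Rightarrow> 'a) set \<Rightarrow> ('a \<times> 'a set) set set"
  where "pointed_coalition_orbits \<Omega> G =
    orbits (sym_grp \<Omega>\<lparr>carrier := G\<rparr>) (pointed_coalitions \<Omega>)
      (\<lambda>g. \<lambda>(i, R) \<in> pointed_coalitions \<Omega>. (g i, g ` R))"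

definition coalition_orbits :: "'a set \<Rightarrow> ('a \<Rightarrow> 'a) set \<Rightarrow> 'a set set set"
  where "coalition_orbits \<Omega> G =
    orbits (sym_grp \<Omega>\<lparr>carrier := G\<rparr>) (coalitions \<Omega>) (\<lambda>g. \<lambda>R \<in> coalitions \<Omega>. g ` R)"

definition num_cycles :: "'a set \<Rightarrow> nat \<Rightarrow> ('a \<Rightarrow> 'a) \<Rightarrow> nat"
  where "num_cycles \<Omega> k \<pi> = card {C \<in> Orbits.orbit \<pi> ` \<Omega>. card C = k}"

definition cycle_index :: "'a set \<Rightarrow> ('a \<Rightarrow> 'a) set \<Rightarrow> (nat \<Rightarrow> real) \<Rightarrow> real"
  where "cycle_index \<Omega> G x =
    1 / real (card G) * (\<Sum>\<pi>\<in>G. \<Prod>k = 1..card \<Omega>. x k ^ num_cycles \<Omega> k \<pi>)"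

definition partial_deriv :: "nat \<Rightarrow> ((nat \<Rightarrow> real) \<Rightarrow> real) \<Rightarrow> (nat \<Rightarrow> real) \<Rightarrow> real"
  where "partial_deriv k f x = deriv (\<lambda>t. f (x(k := t))) (x k)"

end

theory Submission
  imports Defs
begin

text \<open>
  A linear value is determined by its values on the unanimity games \<open>u\<^sub>S\<close>, and the games in which
  \<open>i\<close> is a null player are spanned by the \<open>u\<^sub>S\<close> with \<open>i \<notin> S\<close>. So a quasi-value amounts to a
  function \<open>a(i, S) = \<phi>\<^sub>i(u\<^sub>S)\<close> on \<open>X\<close> with \<open>\<Sum>i\<in>S. a(i, S) = 1\<close> for every coalition \<open>S\<close>, and it is
  \<open>G\<close>-symmetric iff \<open>a\<close> is constant on the orbits of \<open>X\<close>. Scaling the indicator of an orbit \<open>t\<close>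
  such that it sums to \<open>1\<close> over each coalition it meets, one coordinate per orbit of \<open>X\<close> remains,
  subject to one equation for each orbit \<open>o\<close> of \<open>\<chi>\<close>: the coordinates of the orbits lying over \<open>o\<close>
  sum to \<open>1\<close>. The second formula is Burnside's lemma: a permutation with \<open>m\<close> cycles leaves \<open>2^m\<close>
  sets invariant, of which half contain a given fixed point.
\<close>

section \<open>Affine dimension\<close>

text \<open>\<open>affine_dim\<close> is a choice, so the number needs both existence and
  uniqueness. The translate of \<open>S\<close> together with \<open>a\<close> is one affine basis.
  Any other one, shifted by one of its points, becomes a linear basis of \<open>span S\<close>, and
  such bases have equal size.\<close>

lemma affine_dim_translated_span:
  fixes a :: "'v::real_vector"
  assumes "finite S" "independent S"
  shows "affine_dim ((+) a ` span S) = int (card S)"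
proof -
  let ?A = "(+) a ` span S" and ?B = "insert a ((+) a ` S)"
  let ?P = "\<lambda>d :: int. \<exists>B. finite B \<and> affine hull B = affine hull ?A \<and> \<not> affine_dependent B
    \<and> of_nat (card B) = d + 1"
  \<comment> \<open>So \<open>a\<close> lies outside the translate of \<open>S\<close>, and
    \<open>?B\<close> has exactly one element more than \<open>S\<close>, matching the
    \<open>d + 1\<close> in \<open>affine_dim\<close>.\<close>
  have "0 \<notin> S"
    using assms(2) dependent_zero by blast
  then have notin: "a \<notin> (+) a ` S"
    by auto
  have shift: "(\<lambda>x. - a + x) ` ((+) a ` S) = S"
    by (simp add: image_image)
  have hullB: "affine hull ?B = ?A"
    by (simp only: affine_hull_insert_span_gen shift)
  then have hullA: "affine hull ?A = ?A"
    by (metis hull_hull)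
  have "\<not> affine_dependent ?B"
    using assms(2) by (simp only: affine_dependent_iff_dependent[OF notin] shift) simp
  moreover have "card ?B = card S + 1"
    using notin assms(1) by (simp add: card_image)
  ultimately have ex: "?P (int (card S))"
    using assms(1) unfolding hullA by (intro exI[of _ ?B] conjI hullB) auto
  moreover have "d = int (card S)" if P: "?P d" for d
  proof -
    from P obtain B where B: "finite B" "affine hull B = ?A" "\<not> affine_dependent B"
      "of_nat (card B) = d + 1"
      unfolding hullA by blast
    have "?A \<noteq> {}"
      using span_zero by blast
    then obtain b where b: "b \<in> B"
      using B(2) by fastforce
    let ?T = "(\<lambda>x. - b + x) ` (B - {b})"
    have indT: "independent ?T"
      using B(3) affine_dependent_iff_dependent2[OF b] by simp
    have *: "?A = (+) b ` span ?T"
      using affine_hull_insert_span_gen[of b "B - {b}"]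
      unfolding insert_Diff[OF b] B(2) .
    \<comment> \<open>Both base points lie in the same flat, so passing from \<open>b\<close> to
      \<open>a\<close> keeps its direction space.\<close>
    have ba: "b - a \<in> span S"
    proof -
      have "b \<in> ?A"
        using hull_inc[OF b, of affine] B(2) by simp
      then show ?thesis
        by auto
    qed
    have "span ?T = span S"
    proof -
      have "x \<in> span ?T \<longleftrightarrow> x \<in> span S" for x
      proof -
        have "x \<in> span ?T \<longleftrightarrow> b + x \<in> (+) b ` span ?T"
          by (auto simp del: uminus_add_conv_diff)
        also have "\<dots> \<longleftrightarrow> b + x \<in> (+) a ` span S"
          using * by simp
        also have "\<dots> \<longleftrightarrow> (b - a) + x \<in> span S"
          by (auto simp: algebra_simps intro: image_eqI[of _ _ "(b - a) + x"])
        also have "\<dots> \<longleftrightarrow> x \<in> span S"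
          by (rule span_add_eq[OF ba])
        finally show ?thesis .
      qed
      then show ?thesis by blast
    qed
    then have "card ?T = card S"
      using indT assms(2) by (metis dim_span dim_eq_card_independent)
    moreover have "card ?T = card B - 1" "card B > 0"
      using B(1) b by (auto simp: card_image card_gt_0_iff)
    ultimately show ?thesis
      using B(4) by simp
  qed
  ultimately show ?thesis
    unfolding affine_dim_def by (intro some_equality) blast+
qed

text \<open>Independence is assumed of the indexed family, not just of its range. This forces
  \<open>b\<close> to be injective on \<open>J\<close>, so that counting indices counts basis
  vectors.\<close>

lemma affine_dim_family:
  fixes a :: "'v::real_vector" and b :: "'t \<Rightarrow> 'v"
  assumes "finite J" and "\<And>c t. (\<Sum>t\<in>J. c t *\<^sub>R b t) = 0 \<Longrightarrow> t \<in> J \<Longrightarrow> c t = 0"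
  shows "affine_dim {a + (\<Sum>t\<in>J. c t *\<^sub>R b t) | c. True} = int (card J)"
proof -
  have inj: "inj_on b J"
  proof (rule inj_onI, rule ccontr)
    fix s t assume st: "s \<in> J" "t \<in> J" "b s = b t" "s \<noteq> t"
    \<comment> \<open>Equal vectors at two indices would give the nontrivial relation
      \<open>b s - b t = 0\<close>.\<close>
    define c where "c u = (if u = s then 1 else if u = t then - 1 else 0 :: real)" for u
    have "(\<Sum>u\<in>J. c u *\<^sub>R b u) = (\<Sum>u\<in>{s, t}. c u *\<^sub>R b u)"
      using st assms(1) by (intro sum.mono_neutral_right) (auto simp: c_def)
    also have "\<dots> = 0"
      using st by (simp add: c_def)
    finally show False
      using assms(2)[of c s] st by (simp add: c_def)
  qed
  have "independent (b ` J)"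
  proof
    assume "dependent (b ` J)"
    then obtain u where u: "\<exists>v\<in>b ` J. u v \<noteq> 0" "(\<Sum>v\<in>b ` J. u v *\<^sub>R v) = 0"
      using dependent_finite[of "b ` J"] assms(1) by auto
    have "(\<Sum>t\<in>J. u (b t) *\<^sub>R b t) = 0"
      using u(2) by (simp add: sum.reindex[OF inj])
    then show False
      using assms(2)[of "\<lambda>t. u (b t)"] u(1) by auto
  qed
  moreover have "span (b ` J) = {(\<Sum>t\<in>J. c t *\<^sub>R b t) | c. True}" (is "_ = ?R")
  proof -
    have "(\<Sum>v\<in>b ` J. u v *\<^sub>R v) \<in> ?R" for u
      by (auto simp: sum.reindex[OF inj])
    moreover have "(\<Sum>t\<in>J. c t *\<^sub>R b t) \<in> span (b ` J)" for c
      by (intro span_sum span_scale span_base) auto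
    ultimately show ?thesis
      using assms(1) span_finite[of "b ` J"] by fastforce
  qed
  moreover have "{a + (\<Sum>t\<in>J. c t *\<^sub>R b t) | c. True} = (+) a ` ?R"
    by auto
  ultimately show ?thesis
    using affine_dim_translated_span[of "b ` J" a] assms(1) inj by (simp add: card_image)
qed

text \<open>Each equation is solved for the coefficient at one chosen index of its fibre; all other
  coefficients are free. Every value of \<open>P\<close> on \<open>Q\<close> thus costs one
  dimension.\<close>

lemma affine_dim_unit_fibre_sums:
  fixes e :: "'t \<Rightarrow> 'v::real_vector" and P :: "'t \<Rightarrow> 'c"
  assumes fin: "finite Q" and indep: "\<And>c t. (\<Sum>t\<in>Q. c t *\<^sub>R e t) = 0 \<Longrightarrow> t \<in> Q \<Longrightarrow> c t = 0"
  shows "affine_dim {\<Sum>t\<in>Q. c t *\<^sub>R e t | c. \<forall>o'\<in>P ` Q. (\<Sum>t | t \<in> Q \<and> P t = o'. c t) = 1} =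
    int (card Q) - int (card (P ` Q))"
proof -
  \<comment> \<open>\<open>\<sigma>\<close> picks one index in each fibre of \<open>P\<close>.
    \<open>N\<close> collects these dependent indices, and \<open>J\<close> holds the free
    ones.\<close>
  define \<sigma> where "\<sigma> = inv_into Q P"
  have \<sigma>: "\<sigma> o' \<in> Q" "P (\<sigma> o') = o'" if "o' \<in> P ` Q" for o'
    using that by (auto simp: \<sigma>_def inv_into_into f_inv_into_f)
  have inj: "inj_on \<sigma> (P ` Q)"
    by (metis \<sigma>(2) inj_onI)
  define N where "N = \<sigma> ` (P ` Q)"
  define J where "J = Q - N"
  have N: "N \<subseteq> Q" "finite N" "card N = card (P ` Q)"
    using \<sigma> fin inj by (auto simp: N_def card_image)
  have J: "finite J" "Q = J \<union> N" "J \<inter> N = {}"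
    using N fin by (auto simp: J_def)
  have fibre: "(\<Sum>t | t \<in> Q \<and> P t = o'. f t) = (\<Sum>t | t \<in> J \<and> P t = o'. f t) + f (\<sigma> o')"
    if "o' \<in> P ` Q" for o' and f :: "'t \<Rightarrow> real"
  proof -
    have "{t. t \<in> Q \<and> P t = o'} = insert (\<sigma> o') {t. t \<in> J \<and> P t = o'}"
      using that \<sigma> by (auto simp: J_def N_def)
    moreover have "\<sigma> o' \<notin> J"
      using that by (auto simp: J_def N_def)
    ultimately show ?thesis
      using J(1) by simp
  qed
  \<comment> \<open>Replacing each coefficient at \<open>\<sigma> o'\<close> by the fibre sum leaves
    the directions \<open>e t - e (\<sigma> (P t))\<close>, along which no fibre sum
    changes.\<close>
  have split: "(\<Sum>t\<in>Q. c t *\<^sub>R e t) = (\<Sum>o'\<in>P ` Q. (\<Sum>t | t \<in> Q \<and> P t = o'. c t) *\<^sub>R e (\<sigma> o'))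
      + (\<Sum>t\<in>J. c t *\<^sub>R (e t - e (\<sigma> (P t))))" for c
  proof -
    have "(\<Sum>t\<in>J. c t *\<^sub>R e (\<sigma> (P t))) =
        (\<Sum>o'\<in>P ` Q. \<Sum>t | t \<in> J \<and> P t = o'. c t *\<^sub>R e (\<sigma> (P t)))"
      using fin by (intro sum.group[symmetric]) (auto simp: J_def)
    also have "\<dots> = (\<Sum>o'\<in>P ` Q. (\<Sum>t | t \<in> J \<and> P t = o'. c t) *\<^sub>R e (\<sigma> o'))"
      by (simp add: scaleR_sum_left)
    finally have "(\<Sum>o'\<in>P ` Q. (\<Sum>t | t \<in> Q \<and> P t = o'. c t) *\<^sub>R e (\<sigma> o')) =
        (\<Sum>t\<in>J. c t *\<^sub>R e (\<sigma> (P t))) + (\<Sum>o'\<in>P ` Q. c (\<sigma> o') *\<^sub>R e (\<sigma> o'))"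
      by (simp add: fibre scaleR_add_left sum.distrib)
    also have "(\<Sum>o'\<in>P ` Q. c (\<sigma> o') *\<^sub>R e (\<sigma> o')) = (\<Sum>t\<in>N. c t *\<^sub>R e t)"
      by (simp add: N_def sum.reindex[OF inj])
    finally have "(\<Sum>o'\<in>P ` Q. (\<Sum>t | t \<in> Q \<and> P t = o'. c t) *\<^sub>R e (\<sigma> o')) =
        (\<Sum>t\<in>J. c t *\<^sub>R e (\<sigma> (P t))) + (\<Sum>t\<in>N. c t *\<^sub>R e t)" .
    moreover have "(\<Sum>t\<in>Q. c t *\<^sub>R e t) = (\<Sum>t\<in>J. c t *\<^sub>R e t) + (\<Sum>t\<in>N. c t *\<^sub>R e t)"
      unfolding sum.union_disjoint[OF J(1) N(2) J(3), symmetric] by (simp only: J(2)[symmetric])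
    ultimately show ?thesis
      by (simp add: scaleR_diff_right sum_subtractf)
  qed
  define a where "a = (\<Sum>o'\<in>P ` Q. e (\<sigma> o'))"
  \<comment> \<open>Values on \<open>J\<close> are arbitrary, and the chosen index of each fibre
    absorbs the difference to \<open>r\<close>. The case \<open>r = 1\<close> produces points of the
    affine space, \<open>r = 0\<close> linear relations for the independence proof.\<close>
  have complete: "\<exists>c'. (\<forall>t\<in>J. c' t = c t) \<and>
      (\<forall>o'\<in>P ` Q. (\<Sum>t | t \<in> Q \<and> P t = o'. c' t) = r)" for c :: "'t \<Rightarrow> real" and r
  proof -
    define c' where "c' t = (if t \<in> J then c t else r - (\<Sum>s | s \<in> J \<and> P s = P t. c s))" for t
    have "(\<Sum>t | t \<in> Q \<and> P t = o'. c' t) = r" if "o' \<in> P ` Q" for o'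
    proof -
      have "\<sigma> o' \<notin> J"
        using that by (auto simp: J_def N_def)
      then have "c' (\<sigma> o') = r - (\<Sum>s | s \<in> J \<and> P s = o'. c s)"
        using \<sigma>(2)[OF that] by (simp add: c'_def)
      moreover have "(\<Sum>t | t \<in> J \<and> P t = o'. c' t) = (\<Sum>t | t \<in> J \<and> P t = o'. c t)"
        by (intro sum.cong) (auto simp: c'_def)
      ultimately show ?thesis
        by (simp add: fibre[OF that])
    qed
    moreover have "\<forall>t\<in>J. c' t = c t"
      by (simp add: c'_def)
    ultimately show ?thesis
      by blast
  qed
  have "{\<Sum>t\<in>Q. c t *\<^sub>R e t | c. \<forall>o'\<in>P ` Q. (\<Sum>t | t \<in> Q \<and> P t = o'. c t) = 1} =
    {a + (\<Sum>t\<in>J. c t *\<^sub>R (e t - e (\<sigma> (P t)))) | c. True}" (is "?L = ?R")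
  proof
    show "?L \<subseteq> ?R"
    proof
      fix x assume "x \<in> ?L"
      then obtain c where c: "x = (\<Sum>t\<in>Q. c t *\<^sub>R e t)"
        "\<forall>o'\<in>P ` Q. (\<Sum>t | t \<in> Q \<and> P t = o'. c t) = 1"
        by blast
      then have "x = a + (\<Sum>t\<in>J. c t *\<^sub>R (e t - e (\<sigma> (P t))))"
        unfolding c(1) split a_def by (intro arg_cong2[of _ _ _ _ "(+)"] sum.cong) auto
      then show "x \<in> ?R"
        by blast
    qed
    show "?R \<subseteq> ?L"
    proof
      fix x assume "x \<in> ?R"
      then obtain c where x: "x = a + (\<Sum>t\<in>J. c t *\<^sub>R (e t - e (\<sigma> (P t))))"
        by blast
      obtain c' where c': "\<forall>t\<in>J. c' t = c t" "\<forall>o'\<in>P ` Q. (\<Sum>t | t \<in> Q \<and> P t = o'. c' t) = 1"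
        using complete by blast
      have "x = (\<Sum>t\<in>Q. c' t *\<^sub>R e t)"
        unfolding x split a_def using c' by (intro arg_cong2[of _ _ _ _ "(+)"] sum.cong) auto
      then show "x \<in> ?L"
        using c'(2) by blast
    qed
  qed
  also have "affine_dim \<dots> = int (card J)"
  proof (rule affine_dim_family[OF J(1)])
    fix c t assume z: "(\<Sum>t\<in>J. c t *\<^sub>R (e t - e (\<sigma> (P t)))) = 0" and t: "t \<in> J"
    obtain c' where c': "\<forall>t\<in>J. c' t = c t" "\<forall>o'\<in>P ` Q. (\<Sum>t | t \<in> Q \<and> P t = o'. c' t) = 0"
      using complete by blast
    have "(\<Sum>t\<in>Q. c' t *\<^sub>R e t) = 0"
    proof -
      have "(\<Sum>t\<in>J. c' t *\<^sub>R (e t - e (\<sigma> (P t)))) = 0"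
        using c'(1) z by simp
      moreover have "(\<Sum>o'\<in>P ` Q. (\<Sum>t | t \<in> Q \<and> P t = o'. c' t) *\<^sub>R e (\<sigma> o')) = 0"
        using c'(2) by (intro sum.neutral) auto
      ultimately show ?thesis
        unfolding split by (simp only: add_0)
    qed
    then show "c t = 0"
      using indep[of c' t] t c'(1) by (simp add: J_def)
  qed
  also have "int (card J) = int (card Q) - int (card (P ` Q))"
    using N card_mono[OF fin N(1)] by (simp add: J_def card_Diff_subset of_nat_diff)
  finally show ?thesis .
qed


section \<open>Harsanyi dividends\<close>

text \<open>The Moebius transform of \<open>v\<close> on the subset lattice; for a game it gives the
  coefficients in the basis of unanimity games.\<close>

definition dividend :: "'a game \<Rightarrow> 'a set \<Rightarrow> real"
  where "dividend v S = (\<Sum>T\<in>Pow S. (-1) ^ (card S - card T) * v T)"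

text \<open>One half of Moebius inversion. It lets a dividend be computed by guessing
  \<open>d\<close> and checking subset sums below \<open>S\<close> only.\<close>

lemma dividend_unique:
  assumes "finite S" "\<And>T. T \<subseteq> S \<Longrightarrow> v T = sum d (Pow T)"
  shows "dividend v S = d S"
proof -
  have "d S = (\<Sum>T\<in>Pow S. (-1) ^ (card S - card T) * sum d (Pow T))"
    using assms(1) by (intro inclusion_exclusion_mobius) auto
  also have "\<dots> = dividend v S"
    using assms(2) by (simp add: dividend_def)
  finally show ?thesis ..
qed

text \<open>The other half of Moebius inversion: a game is recovered from its dividends.\<close>

lemma sum_dividend:
  assumes "finite S"
  shows "sum (dividend v) (Pow S) = v S"
proof -
  \<comment> \<open>Moving the sign of \<open>T\<close> to the left puts the definition into the
    self-inverse form of inclusion-exclusion.\<close>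
  have pm: "(-1) ^ card T * dividend v T = (\<Sum>U\<in>Pow T. (-1) ^ card U * v U)" if "finite T" for T
    unfolding dividend_def sum_distrib_left
  proof (intro sum.cong refl)
    fix U assume "U \<in> Pow T"
    then have "card U \<le> card T"
      using that by (auto intro: card_mono)
    then have "(-1::real) ^ card T * (-1) ^ (card T - card U) = (-1) ^ card U"
      by (metis (no_types, opaque_lifting) add.commute neg_one_power_add_eq_neg_one_power_diff le_add_diff_inverse
          mult.left_neutral power_add power_minus1_even mult_2 mult.assoc)
    then show "(-1) ^ card T * ((-1) ^ (card T - card U) * v U) = (-1) ^ card U * v U"
      by (simp add: mult.assoc[symmetric])
  qed
  have "v S = (\<Sum>T\<in>Pow S. (-1) ^ card T * ((-1) ^ card T * dividend v T))"
    by (rule inclusion_exclusion_symmetric[where f = v, OF pm assms])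
  also have "\<dots> = sum (dividend v) (Pow S)"
    by (simp add: mult.assoc[symmetric] flip: power_add)
  finally show ?thesis ..
qed

lemma dividend_empty: "dividend v {} = v {}"
  by (simp add: dividend_def)

lemma dividend_linear:
  "dividend (\<alpha> *\<^sub>R v + \<beta> *\<^sub>R w) S = \<alpha> * dividend v S + \<beta> * dividend w S"
  by (simp add: dividend_def scaleR_fun_def sum_distrib_left flip: sum.distrib)
    (simp add: algebra_simps)

text \<open>Below \<open>S\<close>, removing \<open>i\<close> does not change \<open>v\<close>, so
  \<open>v\<close> is already the sum of the dividends of sets avoiding \<open>i\<close>. By
  uniqueness the dividend at \<open>S\<close>, which contains \<open>i\<close>, is zero.\<close>

lemma dividend_null_player:
  assumes "finite \<Omega>" "i \<in> S" "S \<subseteq> \<Omega>" and null: "\<And>R. R \<subseteq> \<Omega> \<Longrightarrow> v (R \<union> {i}) = v R"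
  shows "dividend v S = 0"
proof -
  have fin: "finite S"
    using assms finite_subset by blast
  have eq: "v T = sum (\<lambda>U. if i \<in> U then 0 else dividend v U) (Pow T)" if "T \<subseteq> S" for T
  proof -
    have "v T = v (T - {i})"
      using null[of "T - {i}"] null[of T] that assms(3) by auto
    also have "\<dots> = sum (dividend v) (Pow (T - {i}))"
      using fin that by (intro sum_dividend[symmetric]) (auto intro: finite_subset)
    also have "\<dots> = sum (\<lambda>U. if i \<in> U then 0 else dividend v U) (Pow T)"
      using fin that by (intro sum.mono_neutral_cong_left) (auto intro: finite_subset)
    finally show ?thesis .
  qed
  show ?thesis
    using dividend_unique[OF fin eq] assms(2) by simp
qed

text \<open>Taking images under \<open>\<pi>\<close> matches the subsets of both coalitions and
  preserves cardinality.\<close>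

lemma dividend_permute_game:
  assumes "bij \<pi>"
  shows "dividend (permute_game \<pi> v) (\<pi> ` S) = dividend v S"
proof -
  have inj: "inj \<pi>"
    using assms by (rule bij_is_inj)
  then have c: "card (\<pi> ` T) = card T" for T
    by (meson card_image inj_on_subset subset_UNIV)
  have "dividend (permute_game \<pi> v) (\<pi> ` S) =
      (\<Sum>T\<in>Pow S. (-1) ^ (card (\<pi> ` S) - card (\<pi> ` T)) * permute_game \<pi> v (\<pi> ` T))"
    unfolding dividend_def image_Pow_surj[OF refl, symmetric]
    by (subst sum.reindex) (auto simp: inj_on_image_Pow inj_on_subset[OF inj])
  also have "\<dots> = dividend v S"
    unfolding dividend_def using inj by (simp add: c permute_game_def image_image)
  finally show ?thesis .
qed

text \<open>The condition \<open>R \<subseteq> \<Omega>\<close> enforces the extension by zero used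
  in \<open>games\<close>. For empty \<open>S\<close> this is not a game, since its value at the
  empty set is 1.\<close>

definition unanimity_game :: "'a set \<Rightarrow> 'a set \<Rightarrow> 'a game"
  where "unanimity_game \<Omega> S R = (if S \<subseteq> R \<and> R \<subseteq> \<Omega> then 1 else 0)"

lemma unanimity_game_in_games: "S \<noteq> {} \<Longrightarrow> unanimity_game \<Omega> S \<in> games \<Omega>"
  by (auto simp: games_def unanimity_game_def)

text \<open>Dividends are the coordinates dual to the unanimity games; the guess for
  \<open>dividend_unique\<close> is the indicator of \<open>S\<close>.\<close>

lemma dividend_unanimity_game:
  assumes "finite \<Omega>" "T \<subseteq> \<Omega>"
  shows "dividend (unanimity_game \<Omega> S) T = (if T = S then 1 else 0)"
proof (rule dividend_unique)
  show "finite T"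
    using assms finite_subset by blast
  fix R assume "R \<subseteq> T"
  then have "finite R" "R \<subseteq> \<Omega>"
    using assms by (auto intro: finite_subset)
  then show "unanimity_game \<Omega> S R = (\<Sum>U\<in>Pow R. if U = S then 1 else 0)"
    by (simp add: unanimity_game_def)
qed

lemma sum_scaleR_apply:
  fixes g :: "'t \<Rightarrow> 'b \<Rightarrow> real"
  shows "(\<Sum>t\<in>C. f t *\<^sub>R g t) x = (\<Sum>t\<in>C. f t * g t x)"
  by (induction C rule: infinite_finite_induct) (auto simp: scaleR_fun_def)

lemma game_eq_sum_unanimity_games:
  assumes "finite \<Omega>" "v \<in> games \<Omega>"
  shows "v = (\<Sum>S\<in>coalitions \<Omega>. dividend v S *\<^sub>R unanimity_game \<Omega> S)"
proof
  fix R
  have fin: "finite (coalitions \<Omega>)"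
    using assms(1) by (simp add: coalitions_def)
  show "v R = (\<Sum>S\<in>coalitions \<Omega>. dividend v S *\<^sub>R unanimity_game \<Omega> S) R"
  proof (cases "R \<subseteq> \<Omega>")
    case False
    then show ?thesis
      using assms(2) by (simp add: sum_scaleR_apply unanimity_game_def games_def)
  next
    case True
    have "v R = sum (dividend v) (Pow R)"
      using True assms(1) by (intro sum_dividend[symmetric]) (auto intro: finite_subset)
    \<comment> \<open>The empty set may be dropped because its dividend is
      \<open>v {} = 0\<close>.\<close>
    also have "\<dots> = (\<Sum>S\<in>coalitions \<Omega> \<inter> Pow R. dividend v S)"
      using True assms finite_subset[OF True]
      by (intro sum.mono_neutral_right) (auto simp: coalitions_def games_def dividend_empty)
    also have "\<dots> = (\<Sum>S\<in>coalitions \<Omega>. dividend v S * unanimity_game \<Omega> S R)"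
      using fin True by (intro sum.mono_neutral_cong_left) (auto simp: unanimity_game_def)
    finally show ?thesis
      by (simp add: sum_scaleR_apply)
  qed
qed

section \<open>Quasi-values as sharing values\<close>

text \<open>Each coalition \<open>S\<close> distributes its dividend among its members with weights
  \<open>a (i, S)\<close>. The guard gives the extension by zero demanded by
  \<open>game_values\<close>.\<close>

definition sharing_value :: "'a set \<Rightarrow> ('a \<times> 'a set \<Rightarrow> real) \<Rightarrow> 'a game \<Rightarrow> 'a game"
  where "sharing_value \<Omega> a v R =
    (if v \<in> games \<Omega> \<and> R \<subseteq> \<Omega> then \<Sum>i\<in>R. \<Sum>S | i \<in> S \<and> S \<subseteq> \<Omega>. a (i, S) * dividend v S else 0)"

text \<open>Weights may be negative. Nothing is prescribed off
  \<open>pointed_coalitions \<Omega>\<close>, so different systems can induce the same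
  value.\<close>

definition sharing_systems :: "'a set \<Rightarrow> ('a \<Rightarrow> 'a) set \<Rightarrow> ('a \<times> 'a set \<Rightarrow> real) set"
  where "sharing_systems \<Omega> G = {a.
    (\<forall>g\<in>G. \<forall>(i, S)\<in>pointed_coalitions \<Omega>. a (g i, g ` S) = a (i, S)) \<and>
    (\<forall>S\<in>coalitions \<Omega>. (\<Sum>i\<in>S. a (i, S)) = 1)}"

lemma sharing_value_cong:
  assumes "\<And>i S. i \<in> S \<Longrightarrow> S \<subseteq> \<Omega> \<Longrightarrow> a (i, S) = b (i, S)"
  shows "sharing_value \<Omega> a = sharing_value \<Omega> b"
  using assms by (auto simp: fun_eq_iff sharing_value_def intro!: sum.cong)

lemma sharing_value_sum:
  "sharing_value \<Omega> (\<lambda>x. \<Sum>t\<in>Q. c t * b t x) = (\<Sum>t\<in>Q. c t *\<^sub>R sharing_value \<Omega> (b t))"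
proof (induction Q rule: infinite_finite_induct)
  case (insert t Q)
  have "sharing_value \<Omega> (\<lambda>x. \<Sum>t\<in>insert t Q. c t * b t x) =
      c t *\<^sub>R sharing_value \<Omega> (b t) + sharing_value \<Omega> (\<lambda>x. \<Sum>t\<in>Q. c t * b t x)"
    using insert.hyps
    by (simp add: fun_eq_iff sharing_value_def scaleR_fun_def distrib_right sum.distrib
        sum_distrib_left mult.assoc)
  then show ?case
    using insert by simp
qed (auto simp: fun_eq_iff sharing_value_def)

text \<open>Reads a weight back from the value; the independence of the orbit coordinates rests on
  this.\<close>

lemma sharing_value_unanimity_game:
  assumes "finite \<Omega>" "i \<in> S" "S \<subseteq> \<Omega>"
  shows "sharing_value \<Omega> a (unanimity_game \<Omega> S) {i} = a (i, S)"
proof -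
  have "(\<Sum>T | i \<in> T \<and> T \<subseteq> \<Omega>. a (i, T) * dividend (unanimity_game \<Omega> S) T) =
      (\<Sum>T | i \<in> T \<and> T \<subseteq> \<Omega>. if T = S then a (i, S) else 0)"
    using assms(1) by (intro sum.cong) (auto simp: dividend_unanimity_game)
  also have "\<dots> = a (i, S)"
    using assms by simp
  finally show ?thesis
    using assms unanimity_game_in_games[of S \<Omega>] by (auto simp: sharing_value_def)
qed

lemma games_linear:
  assumes "v \<in> games \<Omega>" "w \<in> games \<Omega>"
  shows "\<alpha> *\<^sub>R v + \<beta> *\<^sub>R w \<in> games \<Omega>"
  using assms by (simp add: games_def scaleR_fun_def)

lemma permute_game_in_games:
  assumes "\<pi> permutes \<Omega>" "v \<in> games \<Omega>"
  shows "permute_game \<pi> v \<in> games \<Omega>"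
proof -
  have "Hilbert_Choice.inv \<pi> ` R \<subseteq> \<Omega> \<longleftrightarrow> R \<subseteq> \<Omega>" for R
    using permutes_in_image[OF permutes_inv[OF assms(1)]] by blast
  then show ?thesis
    using assms(2) by (simp add: permute_game_def games_def)
qed

lemma sum_coalitions_swap:
  assumes "finite \<Omega>"
  shows "(\<Sum>i\<in>\<Omega>. \<Sum>S | i \<in> S \<and> S \<subseteq> \<Omega>. f i S) = (\<Sum>S\<in>coalitions \<Omega>. \<Sum>i\<in>S. f i S)"
proof -
  have "(\<Sum>i\<in>\<Omega>. \<Sum>S | S \<in> coalitions \<Omega> \<and> i \<in> S. f i S) =
      (\<Sum>S\<in>coalitions \<Omega>. \<Sum>i | i \<in> \<Omega> \<and> i \<in> S. f i S)"
    using assms by (intro sum.swap_restrict) (auto simp: coalitions_def)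
  also have "\<dots> = (\<Sum>S\<in>coalitions \<Omega>. \<Sum>i\<in>S. f i S)"
    by (intro sum.cong) (auto simp: coalitions_def)
  also have "(\<Sum>i\<in>\<Omega>. \<Sum>S | S \<in> coalitions \<Omega> \<and> i \<in> S. f i S) =
      (\<Sum>i\<in>\<Omega>. \<Sum>S | i \<in> S \<and> S \<subseteq> \<Omega>. f i S)"
    by (intro sum.cong) (auto simp: coalitions_def)
  finally show ?thesis .
qed

text \<open>Reindexing coalitions by their images under \<open>\<pi>\<close> preserves dividends by
  \<open>dividend_permute_game\<close> and weights by assumption.\<close>

lemma sharing_value_symmetric:
  assumes \<pi>: "\<pi> permutes \<Omega>" and v: "v \<in> games \<Omega>"
    and inv_a: "\<And>i S. i \<in> S \<Longrightarrow> S \<subseteq> \<Omega> \<Longrightarrow> a (\<pi> i, \<pi> ` S) = a (i, S)"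
  shows "sharing_value \<Omega> a (permute_game \<pi> v) = permute_game \<pi> (sharing_value \<Omega> a v)"
proof
  fix R
  define R' where "R' = Hilbert_Choice.inv \<pi> ` R"
  have bij: "bij \<pi>"
    using \<pi> by (rule permutes_bij)
  have R: "R = \<pi> ` R'"
    using bij by (simp add: R'_def image_image bij_is_surj surj_f_inv_f)
  have sub: "\<pi> ` S \<subseteq> \<Omega> \<longleftrightarrow> S \<subseteq> \<Omega>" for S
    using permutes_in_image[OF \<pi>] by blast
  have inj: "inj_on \<pi> A" for A
    using bij by (meson bij_is_inj inj_on_subset subset_UNIV)
  have "(\<Sum>S | \<pi> i \<in> S \<and> S \<subseteq> \<Omega>. a (\<pi> i, S) * dividend (permute_game \<pi> v) S) =
      (\<Sum>S | i \<in> S \<and> S \<subseteq> \<Omega>. a (i, S) * dividend v S)" for i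
  proof (rule sum.reindex_bij_witness[of _ "image \<pi>" "image (Hilbert_Choice.inv \<pi>)"])
    fix S assume S: "S \<in> {S. \<pi> i \<in> S \<and> S \<subseteq> \<Omega>}"
    then obtain T where T: "S = \<pi> ` T"
      using bij by (metis bij_is_surj image_f_inv_f)
    have pre: "Hilbert_Choice.inv \<pi> ` S = T"
      using bij by (simp add: T image_inv_f_f bij_is_inj)
    then show "\<pi> ` (Hilbert_Choice.inv \<pi> ` S) = S"
      using T by simp
    have T': "i \<in> T" "T \<subseteq> \<Omega>"
      using S bij by (auto simp: T sub inj_image_mem_iff bij_is_inj)
    then show "Hilbert_Choice.inv \<pi> ` S \<in> {S. i \<in> S \<and> S \<subseteq> \<Omega>}"
      using pre by simp
    show "a (i, Hilbert_Choice.inv \<pi> ` S) * dividend v (Hilbert_Choice.inv \<pi> ` S) =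
        a (\<pi> i, S) * dividend (permute_game \<pi> v) S"
      unfolding pre unfolding T using inv_a[OF T'] dividend_permute_game[OF bij] by simp
  qed (use bij sub in \<open>auto simp: image_inv_f_f bij_is_inj\<close>)
  then have "(\<Sum>i\<in>R. \<Sum>S | i \<in> S \<and> S \<subseteq> \<Omega>. a (i, S) * dividend (permute_game \<pi> v) S) =
      (\<Sum>i\<in>R'. \<Sum>S | i \<in> S \<and> S \<subseteq> \<Omega>. a (i, S) * dividend v S)"
    unfolding R by (simp add: sum.reindex[OF inj])
  moreover have "R \<subseteq> \<Omega> \<longleftrightarrow> R' \<subseteq> \<Omega>"
    using sub R by simp
  ultimately show "sharing_value \<Omega> a (permute_game \<pi> v) R = permute_game \<pi> (sharing_value \<Omega> a v) R"
    using v permute_game_in_games[OF \<pi> v]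
    unfolding sharing_value_def permute_game_def[of \<pi> "sharing_value \<Omega> a v"] R'_def[symmetric]
    by simp
qed

text \<open>For a null player all dividends involved vanish. Efficiency follows by summing coalition
  by coalition: the shares of each add up to one, and the dividends add up to the value of
  \<open>\<Omega>\<close>.\<close>

lemma sharing_value_in_symmetric_quasi_values:
  assumes fin: "finite \<Omega>" and G: "\<And>g. g \<in> G \<Longrightarrow> g permutes \<Omega>"
    and a: "a \<in> sharing_systems \<Omega> G"
  shows "sharing_value \<Omega> a \<in> symmetric_quasi_values \<Omega> G"
proof -
  let ?\<phi> = "sharing_value \<Omega> a"
  have "?\<phi> v \<in> additive_games \<Omega>" for v
    using fin by (auto simp: additive_games_def games_def sharing_value_def sum.union_disjoint
        finite_subset)
  moreover have "?\<phi> v = 0" if "v \<notin> games \<Omega>" for v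
    using that by (simp add: fun_eq_iff sharing_value_def)
  moreover have "linear_value \<Omega> ?\<phi>"
    unfolding linear_value_def
  proof (intro ballI allI)
    fix v w and \<alpha> \<beta> :: real assume "v \<in> games \<Omega>" "w \<in> games \<Omega>"
    then show "?\<phi> (\<alpha> *\<^sub>R v + \<beta> *\<^sub>R w) = \<alpha> *\<^sub>R ?\<phi> v + \<beta> *\<^sub>R ?\<phi> w"
      by (simp add: fun_eq_iff sharing_value_def games_linear scaleR_fun_def[of _ "?\<phi> _"] dividend_linear
          distrib_left sum.distrib sum_distrib_left mult.left_commute)
  qed
  moreover have "null_player \<Omega> ?\<phi>"
    unfolding null_player_def sharing_value_def
    using fin by (auto intro!: sum.neutral simp: dividend_null_player)
  moreover have "efficient \<Omega> ?\<phi>"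
    unfolding efficient_def
  proof
    fix v assume v: "v \<in> games \<Omega>"
    have "(\<Sum>i\<in>\<Omega>. ?\<phi> v {i}) = (\<Sum>i\<in>\<Omega>. \<Sum>S | i \<in> S \<and> S \<subseteq> \<Omega>. a (i, S) * dividend v S)"
      using v by (intro sum.cong) (auto simp: sharing_value_def)
    also have "\<dots> = (\<Sum>S\<in>coalitions \<Omega>. \<Sum>i\<in>S. a (i, S) * dividend v S)"
      using fin by (rule sum_coalitions_swap)
    also have "\<dots> = (\<Sum>S\<in>coalitions \<Omega>. dividend v S)"
      using a by (simp add: sharing_systems_def flip: sum_distrib_right)
    also have "\<dots> = sum (dividend v) (Pow \<Omega>)"
      using fin v
      by (intro sum.mono_neutral_left) (auto simp: coalitions_def dividend_empty games_def)
    also have "\<dots> = v \<Omega>"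
      using fin by (rule sum_dividend)
    finally show "(\<Sum>i\<in>\<Omega>. ?\<phi> v {i}) = v \<Omega>" .
  qed
  moreover have "?\<phi> (permute_game \<pi> v) = permute_game \<pi> (?\<phi> v)"
    if "\<pi> \<in> G" "v \<in> games \<Omega>" for \<pi> v
    using that a by (intro sharing_value_symmetric G)
      (auto simp: sharing_systems_def pointed_coalitions_def)
  ultimately show ?thesis
    by (simp add: symmetric_quasi_values_def quasi_values_def game_values_def)
qed

lemma additive_game_eq_sum:
  assumes "finite \<Omega>" "v \<in> additive_games \<Omega>" "R \<subseteq> \<Omega>"
  shows "v R = (\<Sum>i\<in>R. v {i})"
proof -
  have additive: "v (R \<union> T) = v R + v T" if "R \<subseteq> \<Omega>" "T \<subseteq> \<Omega>" "R \<inter> T = {}" for R T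
    using assms(2) that by (simp add: additive_games_def)
  have "finite R"
    using assms finite_subset by blast
  then show ?thesis
    using assms(3)
  proof (induction R)
    case empty
    then show ?case
      using assms(2) by (simp add: additive_games_def games_def)
  next
    case (insert i R)
    have "v ({i} \<union> R) = v {i} + v R"
      using insert by (intro additive) auto
    then show ?case
      using insert by simp
  qed
qed

lemma linear_value_sum:
  assumes "linear_value \<Omega> \<phi>" "\<And>t. t \<in> C \<Longrightarrow> u t \<in> games \<Omega>"
  shows "\<phi> (\<Sum>t\<in>C. c t *\<^sub>R u t) = (\<Sum>t\<in>C. c t *\<^sub>R \<phi> (u t))"
proof -
  have 0: "(0 :: 'a game) \<in> games \<Omega>"
    by (simp add: games_def)
  have lin: "\<phi> (\<alpha> *\<^sub>R v + \<beta> *\<^sub>R w) = \<alpha> *\<^sub>R \<phi> v + \<beta> *\<^sub>R \<phi> w"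
    if "v \<in> games \<Omega>" "w \<in> games \<Omega>" for v w \<alpha> \<beta>
    using assms(1) that by (simp add: linear_value_def)
  have \<phi>0: "\<phi> 0 = 0"
    using lin[OF 0 0, of 0 0] by simp
  \<comment> \<open>Linearity is given on \<open>games \<Omega>\<close> only, so membership of the
    partial sums is carried through the induction.\<close>
  have "(\<Sum>t\<in>C. c t *\<^sub>R u t) \<in> games \<Omega> \<and> \<phi> (\<Sum>t\<in>C. c t *\<^sub>R u t) = (\<Sum>t\<in>C. c t *\<^sub>R \<phi> (u t))"
    using assms(2)
  proof (induction C rule: infinite_finite_induct)
    case (insert t C)
    let ?w = "\<Sum>t\<in>C. c t *\<^sub>R u t"
    have w: "?w \<in> games \<Omega>" "\<phi> ?w = (\<Sum>t\<in>C. c t *\<^sub>R \<phi> (u t))" and t: "u t \<in> games \<Omega>"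
      using insert by auto
    show ?case
      using lin[OF t w(1), of "c t" 1] games_linear[OF t w(1), of "c t" 1]
      unfolding sum.insert[OF insert.hyps] w(2) scaleR_one by blast
  qed (simp_all add: 0 \<phi>0)
  then show ?thesis ..
qed

text \<open>The weights are the payoffs in unanimity games. Non-members of \<open>S\<close> are null
  players there, which removes all terms with \<open>i\<close> outside \<open>S\<close> and turns
  efficiency into the condition that the weights on \<open>S\<close> sum to one.\<close>

lemma symmetric_quasi_value_eq_sharing_value:
  assumes fin: "finite \<Omega>" and G: "\<And>g. g \<in> G \<Longrightarrow> g permutes \<Omega>"
    and \<phi>: "\<phi> \<in> symmetric_quasi_values \<Omega> G"
  obtains a where "a \<in> sharing_systems \<Omega> G" "\<phi> = sharing_value \<Omega> a"
proof -
  let ?u = "unanimity_game \<Omega>"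
  define a where "a = (\<lambda>(i, S). \<phi> (?u S) {i})"
  have gv: "\<And>v. v \<in> games \<Omega> \<Longrightarrow> \<phi> v \<in> additive_games \<Omega>" "\<And>v. v \<notin> games \<Omega> \<Longrightarrow> \<phi> v = 0"
    and lin: "linear_value \<Omega> \<phi>" and null: "null_player \<Omega> \<phi>" and eff: "efficient \<Omega> \<phi>"
    and sym: "\<And>\<pi> v. \<pi> \<in> G \<Longrightarrow> v \<in> games \<Omega> \<Longrightarrow> \<phi> (permute_game \<pi> v) = permute_game \<pi> (\<phi> v)"
    using \<phi> by (auto simp: symmetric_quasi_values_def quasi_values_def game_values_def)
  have null_u: "\<phi> (?u S) {i} = 0" if "S \<in> coalitions \<Omega>" "i \<in> \<Omega>" "i \<notin> S" for i S
  proof -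
    have "?u S \<in> games \<Omega>"
      using that by (auto simp: coalitions_def intro: unanimity_game_in_games)
    moreover have "?u S (R \<union> {i}) = ?u S R" if "R \<subseteq> \<Omega>" for R
      using that \<open>i \<in> \<Omega>\<close> \<open>i \<notin> S\<close> by (auto simp: unanimity_game_def)
    ultimately show ?thesis
      using null that(2) unfolding null_player_def by blast
  qed
  have "\<phi> = sharing_value \<Omega> a"
  proof (intro ext)
    fix v R
    show "\<phi> v R = sharing_value \<Omega> a v R"
    proof (cases "v \<in> games \<Omega> \<and> R \<subseteq> \<Omega>")
      case False
      show ?thesis
      proof (cases "v \<in> games \<Omega>")
        case True
        then have "\<phi> v \<in> games \<Omega>"
          using gv(1) by (simp add: additive_games_def)
        moreover have "\<not> R \<subseteq> \<Omega>"
          using False True by blast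
        ultimately show ?thesis
          by (simp add: sharing_value_def games_def)
      next
        case False
        then show ?thesis
          using gv(2) by (simp add: sharing_value_def)
      qed
    next
      case True
      have single: "\<phi> v {i} = (\<Sum>S | i \<in> S \<and> S \<subseteq> \<Omega>. a (i, S) * dividend v S)" if "i \<in> \<Omega>" for i
      proof -
        have "\<phi> v = (\<Sum>S\<in>coalitions \<Omega>. dividend v S *\<^sub>R \<phi> (?u S))"
          using linear_value_sum[OF lin, of "coalitions \<Omega>" ?u "dividend v"] True fin
          by (auto simp: coalitions_def unanimity_game_in_games
              game_eq_sum_unanimity_games[OF fin, of v, symmetric, unfolded coalitions_def])
        then have "\<phi> v {i} = (\<Sum>S\<in>coalitions \<Omega>. dividend v S * \<phi> (?u S) {i})"
          by (simp add: sum_scaleR_apply)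
        also have "\<dots> = (\<Sum>S | i \<in> S \<and> S \<subseteq> \<Omega>. a (i, S) * dividend v S)"
          using fin that
          by (intro sum.mono_neutral_cong_right)
            (auto simp: a_def coalitions_def intro: null_u)
        finally show ?thesis .
      qed
      have "\<phi> v R = (\<Sum>i\<in>R. \<phi> v {i})"
        using True gv fin by (intro additive_game_eq_sum) auto
      also have "\<dots> = (\<Sum>i\<in>R. \<Sum>S | i \<in> S \<and> S \<subseteq> \<Omega>. a (i, S) * dividend v S)"
        using True by (intro sum.cong single) auto
      finally show ?thesis
        using True by (simp add: sharing_value_def)
    qed
  qed
  moreover have "a (g i, g ` S) = a (i, S)" if "g \<in> G" "i \<in> S" "S \<subseteq> \<Omega>" for g i S
  proof -
    have bij: "bij g" and sub: "\<And>R. g ` R \<subseteq> \<Omega> \<longleftrightarrow> R \<subseteq> \<Omega>"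
      using G[OF that(1)] permutes_in_image[OF G[OF that(1)]] by (auto intro: permutes_bij)
    \<comment> \<open>Permuting players permutes the unanimity games, so symmetry of
      \<open>\<phi>\<close> becomes invariance of \<open>a\<close>.\<close>
    have "permute_game g (?u S) = ?u (g ` S)"
    proof
      fix R
      obtain R' where "R = g ` R'"
        using bij by (metis bij_is_surj image_f_inv_f)
      then show "permute_game g (?u S) R = ?u (g ` S) R"
        using bij by (simp add: permute_game_def unanimity_game_def sub image_inv_f_f bij_is_inj
            inj_image_subset_iff)
    qed
    moreover have "?u S \<in> games \<Omega>"
      using that(2) by (intro unanimity_game_in_games) blast
    ultimately have "\<phi> (?u (g ` S)) = permute_game g (\<phi> (?u S))"
      using sym[OF that(1)] by metis
    then show ?thesis
      using bij by (simp add: a_def permute_game_def bij_is_inj)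
  qed
  moreover have "(\<Sum>i\<in>S. a (i, S)) = 1" if "S \<in> coalitions \<Omega>" for S
  proof -
    have "(\<Sum>i\<in>S. a (i, S)) = (\<Sum>i\<in>\<Omega>. \<phi> (?u S) {i})"
      using fin that null_u
      by (intro sum.mono_neutral_cong_left) (auto simp: a_def coalitions_def)
    also have "\<dots> = ?u S \<Omega>"
      using eff that unanimity_game_in_games[of S \<Omega>] by (auto simp: efficient_def coalitions_def)
    also have "\<dots> = 1"
      using that by (simp add: unanimity_game_def coalitions_def)
    finally show ?thesis .
  qed
  ultimately show thesis
    by (intro that[of a]) (auto simp: sharing_systems_def pointed_coalitions_def)
qed

lemma symmetric_quasi_values_eq:
  assumes "finite \<Omega>" "\<And>g. g \<in> G \<Longrightarrow> g permutes \<Omega>"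
  shows "symmetric_quasi_values \<Omega> G = sharing_value \<Omega> ` sharing_systems \<Omega> G"
  using sharing_value_in_symmetric_quasi_values[OF assms]
    symmetric_quasi_value_eq_sharing_value[OF assms] by blast


section \<open>Orbits and the dimension\<close>

lemma group_sym_grp: "group (sym_grp \<Omega>)"
proof (rule groupI)
  fix x assume "x \<in> carrier (sym_grp \<Omega>)"
  then show "\<exists>y\<in>carrier (sym_grp \<Omega>). y \<otimes>\<^bsub>sym_grp \<Omega>\<^esub> x = \<one>\<^bsub>sym_grp \<Omega>\<^esub>"
    by (intro bexI[of _ "Hilbert_Choice.inv x"])
      (auto simp: sym_grp_def permutes_inv_o permutes_inv)
qed (auto simp: sym_grp_def permutes_compose permutes_id o_assoc)

text \<open>Translates the subgroup laws into composition of functions. An inverse is described by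
  its two composition laws, so that the group inverse need not be compared with
  \<open>Hilbert_Choice.inv\<close>.\<close>

lemma subgroup_sym_grp:
  assumes "subgroup G (sym_grp \<Omega>)"
  shows "\<And>g. g \<in> G \<Longrightarrow> g permutes \<Omega>" "id \<in> G" "\<And>g h. g \<in> G \<Longrightarrow> h \<in> G \<Longrightarrow> g \<circ> h \<in> G"
    "\<And>g. g \<in> G \<Longrightarrow> \<exists>h\<in>G. h \<circ> g = id \<and> g \<circ> h = id"
proof -
  show per: "g permutes \<Omega>" if "g \<in> G" for g
    using subgroup.subset[OF assms] that by (auto simp: sym_grp_def)
  show "id \<in> G"
    using subgroup.one_closed[OF assms] by (simp add: sym_grp_def)
  show "g \<circ> h \<in> G" if "g \<in> G" "h \<in> G" for g h
    using subgroup.m_closed[OF assms that] by (simp add: sym_grp_def)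
  fix g assume g: "g \<in> G"
  interpret S: group "sym_grp \<Omega>"
    by (rule group_sym_grp)
  let ?h = "inv\<^bsub>sym_grp \<Omega>\<^esub> g"
  have c: "g \<in> carrier (sym_grp \<Omega>)"
    using per[OF g] by (simp add: sym_grp_def)
  have "?h \<circ> g = id" "g \<circ> ?h = id"
    using S.l_inv[OF c] S.r_inv[OF c] by (simp_all add: sym_grp_def)
  then show "\<exists>h\<in>G. h \<circ> g = id \<and> g \<circ> h = id"
    using subgroup.m_inv_closed[OF assms g] by blast
qed

text \<open>\<open>BijGroup E\<close> consists of bijections that are extensional on
  \<open>E\<close>, hence the \<open>restrict\<close>. Bijectivity comes from the inverse in
  \<open>G\<close>.\<close>

lemma group_action_restrict:
  assumes G: "subgroup G (sym_grp \<Omega>)"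
    and cl: "\<And>g x. g \<in> G \<Longrightarrow> x \<in> E \<Longrightarrow> f g x \<in> E"
    and id: "\<And>x. x \<in> E \<Longrightarrow> f id x = x"
    and comp: "\<And>g h x. g \<in> G \<Longrightarrow> h \<in> G \<Longrightarrow> x \<in> E \<Longrightarrow> f (g \<circ> h) x = f g (f h x)"
  shows "group_action (sym_grp \<Omega>\<lparr>carrier := G\<rparr>) E (\<lambda>g. restrict (f g) E)"
proof -
  have bij: "restrict (f g) E \<in> Bij E" if g: "g \<in> G" for g
  proof -
    obtain h where h: "h \<in> G" "h \<circ> g = id" "g \<circ> h = id"
      using subgroup_sym_grp(4)[OF G g] by blast
    have "f h (f g x) = x" "f g (f h x) = x" if "x \<in> E" for x
      using comp[OF g h(1) that] comp[OF h(1) g that] h id that by simp_all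
    then have "bij_betw (f g) E E"
      using cl g h(1) by (intro bij_betw_byWitness[of E "f h"]) auto
    then have "bij_betw (restrict (f g) E) E E"
      by (subst bij_betw_cong[of E _ "f g"]) auto
    then show ?thesis
      by (simp add: Bij_def)
  qed
  have "group (sym_grp \<Omega>\<lparr>carrier := G\<rparr>)"
    by (rule subgroup.subgroup_is_group[OF G group_sym_grp])
  moreover have "group (BijGroup E)"
    by (rule group_BijGroup)
  moreover have "restrict (f (g \<circ> h)) E = compose E (restrict (f g) E) (restrict (f h) E)"
    if "g \<in> G" "h \<in> G" for g h
    using that cl comp by (auto simp: compose_def restrict_def fun_eq_iff)
  ultimately show ?thesis
    using bij by (auto simp: group_action_def group_hom_def group_hom_axioms_def hom_def
        BijGroup_def sym_grp_def)
qed

lemma image_subset_of_permutes: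
  assumes "subgroup G (sym_grp \<Omega>)" "g \<in> G" "R \<subseteq> \<Omega>"
  shows "g ` R \<subseteq> \<Omega>"
  using image_mono[OF assms(3), of g] permutes_image[OF subgroup_sym_grp(1)[OF assms(1,2)]] by simp

lemma group_action_pointed_coalitions:
  assumes G: "subgroup G (sym_grp \<Omega>)"
  shows "group_action (sym_grp \<Omega>\<lparr>carrier := G\<rparr>) (pointed_coalitions \<Omega>)
    (\<lambda>g. \<lambda>(i, R) \<in> pointed_coalitions \<Omega>. (g i, g ` R))"
proof (rule group_action_restrict[OF G])
  fix g x assume g: "g \<in> G" and x: "x \<in> pointed_coalitions \<Omega>"
  obtain i R where "x = (i, R)" "i \<in> R" "R \<subseteq> \<Omega>"
    using x by (auto simp: pointed_coalitions_def)
  then show "(case x of (i, R) \<Rightarrow> (g i, g ` R)) \<in> pointed_coalitions \<Omega>"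
    using image_subset_of_permutes[OF G g] by (simp add: pointed_coalitions_def)
qed (simp_all add: case_prod_unfold image_comp)

lemma group_action_coalitions:
  assumes G: "subgroup G (sym_grp \<Omega>)"
  shows "group_action (sym_grp \<Omega>\<lparr>carrier := G\<rparr>) (coalitions \<Omega>) (\<lambda>g. \<lambda>R \<in> coalitions \<Omega>. g ` R)"
proof (rule group_action_restrict[OF G])
  fix g R assume "g \<in> G" "R \<in> coalitions \<Omega>"
  then show "g ` R \<in> coalitions \<Omega>"
    using image_subset_of_permutes[OF G] by (simp add: coalitions_def)
qed (simp_all add: image_comp)

lemma finite_pointed_coalitions:
  assumes "finite \<Omega>"
  shows "finite (pointed_coalitions \<Omega>)"
  by (rule finite_subset[of _ "\<Omega> \<times> Pow \<Omega>"]) (use assms in \<open>auto simp: pointed_coalitions_def\<close>)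

lemma pointed_coalition_orbits_eq:
  "pointed_coalition_orbits \<Omega> G =
    (\<lambda>(i, S). {(g i, g ` S) | g. g \<in> G}) ` pointed_coalitions \<Omega>"
  unfolding pointed_coalition_orbits_def orbits_def setcompr_eq_image
  by (intro image_cong) (auto simp: Group_Action.orbit_def)

lemma coalition_orbits_eq: "coalition_orbits \<Omega> G = (\<lambda>S. {g ` S | g. g \<in> G}) ` coalitions \<Omega>"
  unfolding coalition_orbits_def orbits_def setcompr_eq_image
  by (intro image_cong) (auto simp: Group_Action.orbit_def)

text \<open>Orbits partition the set of pairs, so every member of an orbit generates it.\<close>

lemma pointed_coalition_orbit_eq:
  assumes G: "subgroup G (sym_grp \<Omega>)"
    and t: "t \<in> pointed_coalition_orbits \<Omega> G" and x: "(i, S) \<in> t"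
  shows "i \<in> S" "S \<subseteq> \<Omega>" "t = {(g i, g ` S) | g. g \<in> G}"
proof -
  let ?act = "\<lambda>g. \<lambda>(i, R) \<in> pointed_coalitions \<Omega>. (g i, g ` R)"
  let ?A = "sym_grp \<Omega>\<lparr>carrier := G\<rparr>"
  interpret group_action ?A "pointed_coalitions \<Omega>" ?act
    by (rule group_action_pointed_coalitions[OF G])
  have t': "t \<in> orbits ?A (pointed_coalitions \<Omega>) ?act"
    using t by (simp add: pointed_coalition_orbits_def)
  have part: "partition (pointed_coalitions \<Omega>) (orbits ?A (pointed_coalitions \<Omega>) ?act)"
    by (rule orbit_partition)
  have X: "(i, S) \<in> pointed_coalitions \<Omega>"
    using partition.incl[OF part t'] x by blast
  then show "i \<in> S" "S \<subseteq> \<Omega>"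
    by (auto simp: pointed_coalitions_def)
  have "Group_Action.orbit ?A ?act (i, S) \<in> orbits ?A (pointed_coalitions \<Omega>) ?act"
    using X by (auto simp: orbits_def)
  then have "t = Group_Action.orbit ?A ?act (i, S)"
    using partition.unique_class[OF part X] x t' orbit_refl[OF X] by blast
  then show "t = {(g i, g ` S) | g. g \<in> G}"
    using X by (simp add: Group_Action.orbit_def)
qed

text \<open>Forgetting the player sends orbits of pairs to orbits of coalitions. The map is onto
  because every coalition has a member; its fibres index the equations in the dimension
  count.\<close>

lemma snd_image_pointed_coalition_orbits:
  "image snd ` pointed_coalition_orbits \<Omega> G = coalition_orbits \<Omega> G"
proof -
  have img: "snd ` {(g i, g ` S) | g. g \<in> G} = {g ` S | g. g \<in> G}" for i :: 'a and S
    by (simp add: setcompr_eq_image image_image)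
  have "S \<in> snd ` pointed_coalitions \<Omega>" if "S \<in> coalitions \<Omega>" for S
  proof -
    obtain i where "i \<in> S"
      using \<open>S \<in> coalitions \<Omega>\<close> by (auto simp: coalitions_def)
    then have "(i, S) \<in> pointed_coalitions \<Omega>"
      using that by (simp add: pointed_coalitions_def coalitions_def)
    then show ?thesis
      by (rule rev_image_eqI) simp
  qed
  then have "coalitions \<Omega> = snd ` pointed_coalitions \<Omega>"
    by (auto simp: coalitions_def pointed_coalitions_def)
  then show ?thesis
    unfolding pointed_coalition_orbits_eq coalition_orbits_eq case_prod_unfold
    by (simp only: image_image img)
qed

text \<open>The normalisation makes every coefficient in the resulting equations equal to 0 or
  1.\<close>

definition orbit_sharing :: "('a \<times> 'a set) set \<Rightarrow> 'a \<times> 'a set \<Rightarrow> real"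
  where "orbit_sharing t = (\<lambda>(i, S). if (i, S) \<in> t then 1 / real (card {j. (j, S) \<in> t}) else 0)"

section \<open>Coordinates of symmetric quasi-values indexed by orbits of pairs\<close>

context
  fixes \<Omega> :: "'a set" and G :: "('a \<Rightarrow> 'a) set" and Q
  assumes fin: "finite \<Omega>" and G: "subgroup G (sym_grp \<Omega>)"
  defines "Q \<equiv> pointed_coalition_orbits \<Omega> G"
begin

lemma finite_Q: "finite Q"
  using finite_pointed_coalitions[OF fin] by (simp add: Q_def pointed_coalition_orbits_eq)

lemma mem_orbit_iff:
  assumes t: "t \<in> Q" and g: "g \<in> G"
  shows "(g i, g ` S) \<in> t \<longleftrightarrow> (i, S) \<in> t"
proof
  assume "(i, S) \<in> t"
  then show "(g i, g ` S) \<in> t"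
    using pointed_coalition_orbit_eq(3)[OF G t[unfolded Q_def]] g by blast
next
  assume x: "(g i, g ` S) \<in> t"
  obtain h where h: "h \<in> G" "h \<circ> g = id"
    using subgroup_sym_grp(4)[OF G g] by blast
  have "(h (g i), h ` g ` S) \<in> t"
    using pointed_coalition_orbit_eq(3)[OF G t[unfolded Q_def] x] h(1) by blast
  then show "(i, S) \<in> t"
    using h(2) by (simp add: image_comp pointfree_idE)
qed

lemma mem_own_orbit: "(i, S) \<in> {(g i, g ` S) | g. g \<in> G}"
proof -
  have "(i, S) = (id i, id ` S)"
    by simp
  then show ?thesis
    using subgroup_sym_grp(2)[OF G] by blast
qed

lemma orbit_eqI:
  assumes "t \<in> Q" "t' \<in> Q" "(i, S) \<in> t" "(i, S) \<in> t'"
  shows "t = t'"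
  using pointed_coalition_orbit_eq(3)[OF G assms(1)[unfolded Q_def] assms(3)]
    pointed_coalition_orbit_eq(3)[OF G assms(2)[unfolded Q_def] assms(4)] by (simp only:)

lemma orbit_exists:
  assumes "i \<in> S" "S \<subseteq> \<Omega>"
  obtains t where "t \<in> Q" "(i, S) \<in> t"
proof
  show "{(g i, g ` S) | g. g \<in> G} \<in> Q"
    unfolding Q_def pointed_coalition_orbits_eq
    by (rule rev_image_eqI[of "(i, S)"]) (use assms in \<open>auto simp: pointed_coalitions_def\<close>)
  show "(i, S) \<in> {(g i, g ` S) | g. g \<in> G}"
    by (rule mem_own_orbit)
qed

lemma orbit_sharing_pos:
  assumes "t \<in> Q" "(i, S) \<in> t"
  shows "orbit_sharing t (i, S) > 0"
proof -
  have "{j. (j, S) \<in> t} \<subseteq> \<Omega>"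
    using pointed_coalition_orbit_eq(1,2)[OF G assms(1)[unfolded Q_def]] by blast
  then have "finite {j. (j, S) \<in> t}"
    using fin finite_subset by blast
  then have "card {j. (j, S) \<in> t} > 0"
    using assms(2) by (auto simp: card_gt_0_iff)
  then show ?thesis
    using assms(2) by (simp add: orbit_sharing_def)
qed

lemma orbit_sharing_invariant:
  assumes t: "t \<in> Q" and g: "g \<in> G"
  shows "orbit_sharing t (g i, g ` S) = orbit_sharing t (i, S)"
proof -
  \<comment> \<open>A player paired with the image of \<open>S\<close> belongs to that image, hence
    is \<open>g\<close> of some player, and \<open>mem_orbit_iff\<close> applies.\<close>
  have "{j. (j, g ` S) \<in> t} = g ` {j. (j, S) \<in> t}"
    using mem_orbit_iff[OF t g, of _ S] pointed_coalition_orbit_eq(1)[OF G t[unfolded Q_def]]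
    by blast
  moreover have "inj_on g A" for A
    using permutes_inj[OF subgroup_sym_grp(1)[OF G g]] inj_on_subset by blast
  ultimately show ?thesis
    using mem_orbit_iff[OF t g] by (simp add: orbit_sharing_def card_image)
qed

lemma sum_orbit_sharing:
  assumes t: "t \<in> Q" and S: "S \<subseteq> \<Omega>"
  shows "(\<Sum>i\<in>S. orbit_sharing t (i, S)) = (if S \<in> snd ` t then 1 else 0)"
proof (cases "S \<in> snd ` t")
  case True
  then obtain i where i: "(i, S) \<in> t"
    by force
  have sub: "{j. (j, S) \<in> t} \<subseteq> S"
    using pointed_coalition_orbit_eq(1)[OF G t[unfolded Q_def]] by blast
  have "(\<Sum>i\<in>S. orbit_sharing t (i, S)) = (\<Sum>i | (i, S) \<in> t. 1 / real (card {j. (j, S) \<in> t}))"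
    using sub finite_subset[OF S fin]
    by (intro sum.mono_neutral_cong_right) (auto simp: orbit_sharing_def)
  \<comment> \<open>Positivity of the weight guarantees that the cardinality in the denominator is
    nonzero.\<close>
  also have "\<dots> = 1"
    using orbit_sharing_pos[OF t i] i by (simp add: orbit_sharing_def)
  finally show ?thesis
    using True by simp
next
  case False
  then show ?thesis
    by (force simp: orbit_sharing_def intro!: sum.neutral)
qed

text \<open>The total over \<open>S\<close> depends only on the orbit of \<open>S\<close>, which is
  why one equation per orbit of coalitions remains.\<close>

lemma sum_orbit_combination:
  assumes S: "S \<in> coalitions \<Omega>"
  shows "(\<Sum>i\<in>S. \<Sum>t\<in>Q. c t * orbit_sharing t (i, S)) =
    (\<Sum>t | t \<in> Q \<and> snd ` t = {g ` S | g. g \<in> G}. c t)"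
proof -
  \<comment> \<open>An orbit of pairs meets \<open>S\<close> exactly when it lies over the orbit of
    \<open>S\<close>.\<close>
  have snd: "S \<in> snd ` t \<longleftrightarrow> snd ` t = {g ` S | g. g \<in> G}" if "t \<in> Q" for t
  proof
    assume "S \<in> snd ` t"
    then obtain i where "(i, S) \<in> t"
      by force
    then have "t = {(g i, g ` S) | g. g \<in> G}"
      using pointed_coalition_orbit_eq(3)[OF G that[unfolded Q_def]] by blast
    then show "snd ` t = {g ` S | g. g \<in> G}"
      by (simp add: setcompr_eq_image image_image)
  next
    assume "snd ` t = {g ` S | g. g \<in> G}"
    moreover have "S = id ` S"
      by simp
    ultimately show "S \<in> snd ` t"
      using subgroup_sym_grp(2)[OF G] by blast
  qed
  have "(\<Sum>i\<in>S. \<Sum>t\<in>Q. c t * orbit_sharing t (i, S)) =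
      (\<Sum>t\<in>Q. c t * (\<Sum>i\<in>S. orbit_sharing t (i, S)))"
    by (subst sum.swap) (simp add: sum_distrib_left)
  also have "\<dots> = (\<Sum>t\<in>Q. if S \<in> snd ` t then c t else 0)"
    using S by (intro sum.cong) (auto simp: sum_orbit_sharing coalitions_def)
  also have "\<dots> = (\<Sum>t | t \<in> Q \<and> S \<in> snd ` t. c t)"
    using finite_Q by (simp add: sum.inter_filter)
  also have "{t. t \<in> Q \<and> S \<in> snd ` t} = {t. t \<in> Q \<and> snd ` t = {g ` S | g. g \<in> G}}"
    using snd by blast
  finally show ?thesis .
qed

lemma orbit_combination_eq:
  assumes "t \<in> Q" "(i, S) \<in> t"
  shows "(\<Sum>t\<in>Q. c t * orbit_sharing t (i, S)) = c t * orbit_sharing t (i, S)"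
proof -
  have "(\<Sum>t\<in>Q. c t * orbit_sharing t (i, S)) = (\<Sum>t\<in>{t}. c t * orbit_sharing t (i, S))"
  proof (rule sum.mono_neutral_right[OF finite_Q])
    show "\<forall>s\<in>Q - {t}. c s * orbit_sharing s (i, S) = 0"
      using orbit_eqI[OF assms(1) _ assms(2)] by (auto simp: orbit_sharing_def)
  qed (use assms(1) in auto)
  then show ?thesis
    by simp
qed

lemma symmetric_quasi_values_eq_combinations:
  "symmetric_quasi_values \<Omega> G =
    {\<Sum>t\<in>Q. c t *\<^sub>R sharing_value \<Omega> (orbit_sharing t) | c.
      \<forall>o'\<in>image snd ` Q. (\<Sum>t | t \<in> Q \<and> snd ` t = o'. c t) = 1}" (is "_ = ?R")
proof -
  have orb: "image snd ` Q = (\<lambda>S. {g ` S | g. g \<in> G}) ` coalitions \<Omega>"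
    unfolding Q_def snd_image_pointed_coalition_orbits coalition_orbits_eq ..
  have SQV: "symmetric_quasi_values \<Omega> G = sharing_value \<Omega> ` sharing_systems \<Omega> G"
    using subgroup_sym_grp(1)[OF G] by (rule symmetric_quasi_values_eq[OF fin])
  show ?thesis
  proof
    show "?R \<subseteq> symmetric_quasi_values \<Omega> G"
    proof
      fix \<phi> assume "\<phi> \<in> ?R"
      then obtain c where \<phi>: "\<phi> = (\<Sum>t\<in>Q. c t *\<^sub>R sharing_value \<Omega> (orbit_sharing t))"
        and c: "\<forall>o'\<in>image snd ` Q. (\<Sum>t | t \<in> Q \<and> snd ` t = o'. c t) = 1"
        by blast
      let ?a = "\<lambda>x. \<Sum>t\<in>Q. c t * orbit_sharing t x"
      have "(\<Sum>i\<in>S. ?a (i, S)) = 1" if "S \<in> coalitions \<Omega>" for S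
        unfolding sum_orbit_combination[OF that] using c that unfolding orb by blast
      moreover have "?a (g i, g ` S) = ?a (i, S)" if "g \<in> G" for g i S
        using that by (intro sum.cong) (auto simp: orbit_sharing_invariant)
      ultimately have "?a \<in> sharing_systems \<Omega> G"
        by (auto simp: sharing_systems_def)
      then show "\<phi> \<in> symmetric_quasi_values \<Omega> G"
        unfolding SQV \<phi> sharing_value_sum[symmetric] by (rule imageI)
    qed
    show "symmetric_quasi_values \<Omega> G \<subseteq> ?R"
    proof
      fix \<phi> assume "\<phi> \<in> symmetric_quasi_values \<Omega> G"
      then obtain a where a: "a \<in> sharing_systems \<Omega> G" and \<phi>: "\<phi> = sharing_value \<Omega> a"
        unfolding SQV by blast
      have inv_a: "a (g i, g ` S) = a (i, S)" if "g \<in> G" "i \<in> S" "S \<subseteq> \<Omega>" for g i S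
        using a that by (auto simp: sharing_systems_def pointed_coalitions_def)
      define x where "x t = (SOME x. x \<in> t)" for t :: "('a \<times> 'a set) set"
      \<comment> \<open>The coordinate is read off at an arbitrary point of the orbit: numerator and
        denominator are both \<open>G\<close>-invariant, so the choice is immaterial for
        \<open>t \<in> Q\<close>.\<close>
      define c where "c t = a (x t) / orbit_sharing t (x t)" for t
      have a_eq: "a (i, S) = (\<Sum>t\<in>Q. c t * orbit_sharing t (i, S))" if iS: "i \<in> S" "S \<subseteq> \<Omega>" for i S
      proof -
        obtain t where t: "t \<in> Q" "(i, S) \<in> t"
          using orbit_exists[OF iS] .
        have "x t \<in> t"
          unfolding x_def using t(2) by (rule someI)
        then obtain g where g: "g \<in> G" "x t = (g i, g ` S)"
          using pointed_coalition_orbit_eq(3)[OF G t(1)[unfolded Q_def] t(2)] by blast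
        have "c t = a (i, S) / orbit_sharing t (i, S)"
          unfolding c_def g(2) orbit_sharing_invariant[OF t(1) g(1)] inv_a[OF g(1) iS] ..
        then show ?thesis
          using orbit_sharing_pos[OF t] by (simp add: orbit_combination_eq[OF t])
      qed
      have "\<phi> = sharing_value \<Omega> (\<lambda>x. \<Sum>t\<in>Q. c t * orbit_sharing t x)"
        unfolding \<phi> by (rule sharing_value_cong) (rule a_eq)
      moreover have "(\<Sum>t | t \<in> Q \<and> snd ` t = o'. c t) = 1" if o': "o' \<in> image snd ` Q" for o'
      proof -
        obtain S where S: "S \<in> coalitions \<Omega>" "o' = {g ` S | g. g \<in> G}"
          using o' unfolding orb by (auto simp only: image_iff)
        have "(\<Sum>t | t \<in> Q \<and> snd ` t = o'. c t) = (\<Sum>i\<in>S. \<Sum>t\<in>Q. c t * orbit_sharing t (i, S))"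
          unfolding S(2) sum_orbit_combination[OF S(1)] ..
        also have "\<dots> = (\<Sum>i\<in>S. a (i, S))"
          using S(1) by (intro sum.cong) (auto simp: a_eq coalitions_def)
        also have "\<dots> = 1"
          using a S(1) by (simp add: sharing_systems_def)
        finally show ?thesis .
      qed
      ultimately show "\<phi> \<in> ?R"
        unfolding sharing_value_sum by blast
    qed
  qed
qed

text \<open>\<open>affine_dim_unit_fibre_sums\<close> applies with \<open>image snd\<close> as the
  fibre map. For independence, a vanishing combination is evaluated at the unanimity game of
  \<open>S\<close> and the player \<open>i\<close> for a pair in \<open>t\<close>, which isolates
  the coefficient of \<open>t\<close>.\<close>

lemma affine_dim_symmetric_quasi_values:
  "affine_dim (symmetric_quasi_values \<Omega> G) =
    int (card (pointed_coalition_orbits \<Omega> G)) - int (card (coalition_orbits \<Omega> G))"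
  unfolding symmetric_quasi_values_eq_combinations Q_def[symmetric]
    snd_image_pointed_coalition_orbits[symmetric]
proof (rule affine_dim_unit_fibre_sums[OF finite_Q])
  fix c t
  assume z: "(\<Sum>t\<in>Q. c t *\<^sub>R sharing_value \<Omega> (orbit_sharing t)) = 0" and t: "t \<in> Q"
  obtain i S where x: "(i, S) \<in> t" "i \<in> S" "S \<subseteq> \<Omega>"
  proof -
    obtain i S where iS: "i \<in> S" "S \<subseteq> \<Omega>" "t = {(g i, g ` S) | g. g \<in> G}"
      using t by (auto simp: Q_def pointed_coalition_orbits_eq pointed_coalitions_def)
    then have "(i, S) \<in> t"
      using mem_own_orbit by simp
    then show thesis
      using iS that by blast
  qed
  have "c t * orbit_sharing t (i, S) = (\<Sum>t\<in>Q. c t * orbit_sharing t (i, S))"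
    using orbit_combination_eq[OF t x(1)] by simp
  also have "\<dots> = sharing_value \<Omega> (\<lambda>x. \<Sum>t\<in>Q. c t * orbit_sharing t x) (unanimity_game \<Omega> S) {i}"
    by (rule sharing_value_unanimity_game[OF fin x(2,3), symmetric])
  also have "\<dots> = 0"
    unfolding sharing_value_sum z by simp
  finally show "c t = 0"
    using orbit_sharing_pos[OF t x(1)] by simp
qed

end


section \<open>Counting orbits\<close>

text \<open>Unlike \<open>coalitions\<close>, this includes the empty set, which makes the count a
  power of two.\<close>

definition invariant_coalitions :: "'a set \<Rightarrow> ('a \<Rightarrow> 'a) \<Rightarrow> 'a set set"
  where "invariant_coalitions \<Omega> g = {R. R \<subseteq> \<Omega> \<and> g ` R = R}"

text \<open>Invariant sets are exactly the unions of cycles, and a union of cycles determines its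
  cycles because they are disjoint.\<close>

lemma card_invariant_coalitions:
  assumes fin: "finite \<Omega>" and g: "g permutes \<Omega>"
  shows "card (invariant_coalitions \<Omega> g) = 2 ^ card (Orbits.orbit g ` \<Omega>)"
proof -
  let ?O = "Orbits.orbit g"
  \<comment> \<open>\<open>Orbits.orbit\<close> starts at \<open>g x\<close>, so \<open>x\<close>
    itself is reached only because \<open>g\<close> is a permutation of a finite set.\<close>
  have self: "x \<in> ?O x" for x
    using permutation_self_in_orbit[of g x] fin g permutation_permutes by blast
  have same: "?O x = ?O y" if "x \<in> ?O y" for x y
    using cyclic_on_orbit[OF g fin, of y] that unfolding cyclic_on_alldef by blast
  have closed: "?O x \<subseteq> R" if "g ` R = R" "x \<in> R" for x R
  proof
    fix y assume "y \<in> ?O x"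
    then show "y \<in> R"
      using that by induction auto
  qed
  have "bij_betw (\<lambda>R. ?O ` R) (invariant_coalitions \<Omega> g) (Pow (?O ` \<Omega>))"
  proof (rule bij_betw_byWitness[where f' = Union])
    show "\<forall>R\<in>invariant_coalitions \<Omega> g. \<Union>(?O ` R) = R"
    proof
      fix R assume "R \<in> invariant_coalitions \<Omega> g"
      then have "g ` R = R"
        by (simp add: invariant_coalitions_def)
      then show "\<Union>(?O ` R) = R"
        using closed[of R] self by blast
    qed
    show "\<forall>D\<in>Pow (?O ` \<Omega>). ?O ` \<Union>D = D"
    proof
      fix D assume D: "D \<in> Pow (?O ` \<Omega>)"
      have "?O x \<in> D" if "x \<in> c" "c \<in> D" for x c
      proof -
        obtain y where "c = ?O y"
          using D \<open>c \<in> D\<close> by auto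
        then show ?thesis
          using that same[of x y] by simp
      qed
      moreover have "c \<in> ?O ` \<Union>D" if c: "c \<in> D" for c
      proof -
        obtain y where "c = ?O y"
          using c D by auto
        then show ?thesis
          using self[of y] c by blast
      qed
      ultimately show "?O ` \<Union>D = D"
        by blast
    qed
    show "(\<lambda>R. ?O ` R) ` invariant_coalitions \<Omega> g \<subseteq> Pow (?O ` \<Omega>)"
      by (auto simp: invariant_coalitions_def)
    show "Union ` Pow (?O ` \<Omega>) \<subseteq> invariant_coalitions \<Omega> g"
    proof
      fix R assume "R \<in> Union ` Pow (?O ` \<Omega>)"
      then obtain D where D: "D \<subseteq> ?O ` \<Omega>" "R = \<Union>D"
        by auto
      have sub: "R \<subseteq> \<Omega>"
        using D permutes_orbit_subset[OF g] by blast
      have "g y \<in> c" if "y \<in> c" "c \<in> D" for y c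
      proof -
        obtain x where "c = ?O x"
          using D(1) \<open>c \<in> D\<close> by auto
        then show ?thesis
          using \<open>y \<in> c\<close> by (simp add: orbit.step)
      qed
      then have "g ` R \<subseteq> R"
        using D(2) by blast
      \<comment> \<open>An injective self-map of a finite set is onto.\<close>
      then have "g ` R = R"
        using finite_subset[OF sub fin] permutes_inj[OF g]
        by (intro endo_inj_surj) (auto intro: inj_on_subset)
      then show "R \<in> invariant_coalitions \<Omega> g"
        using sub by (simp add: invariant_coalitions_def)
    qed
  qed
  then show ?thesis
    using fin by (simp add: bij_betw_same_card[of _ "invariant_coalitions \<Omega> g"] card_Pow)
qed

text \<open>Inserting the fixed point \<open>i\<close> pairs the invariant coalitions avoiding it with those
  containing it.\<close>

lemma card_invariant_coalitions_containing:
  assumes fin: "finite \<Omega>" and g: "g permutes \<Omega>" and i: "i \<in> \<Omega>" "g i = i"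
  shows "2 * card {R \<in> invariant_coalitions \<Omega> g. i \<in> R} = 2 ^ card (Orbits.orbit g ` \<Omega>)"
proof -
  let ?I = "{R \<in> invariant_coalitions \<Omega> g. i \<in> R}" and ?E = "{R \<in> invariant_coalitions \<Omega> g. i \<notin> R}"
  have inj: "inj g"
    using g by (rule permutes_inj)
  have "bij_betw (insert i) ?E ?I"
  proof (rule bij_betw_byWitness[where f' = "\<lambda>R. R - {i}"])
    show "insert i ` ?E \<subseteq> ?I"
      using i by (auto simp: invariant_coalitions_def)
    have "g ` (R - {i}) = R - {i}" if "g ` R = R" for R
      using that i(2) by (simp add: image_set_diff[OF inj])
    then show "(\<lambda>R. R - {i}) ` ?I \<subseteq> ?E"
      unfolding invariant_coalitions_def by blast
  qed auto
  then have "card ?E = card ?I"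
    by (rule bij_betw_same_card)
  moreover have "card (invariant_coalitions \<Omega> g) = card ?I + card ?E"
  proof -
    have "finite (invariant_coalitions \<Omega> g)"
      using fin by (simp add: invariant_coalitions_def)
    then have "card (?I \<union> ?E) = card ?I + card ?E"
      by (intro card_Un_disjoint) auto
    moreover have "?I \<union> ?E = invariant_coalitions \<Omega> g"
      by blast
    ultimately show ?thesis
      by simp
  qed
  ultimately show ?thesis
    using card_invariant_coalitions[OF fin g] by simp
qed

text \<open>Cycles of size one are the singletons of fixed points.\<close>

lemma num_cycles_1:
  assumes fin: "finite \<Omega>" and g: "g permutes \<Omega>"
  shows "num_cycles \<Omega> 1 g = card {i \<in> \<Omega>. g i = i}"
proof -
  let ?O = "Orbits.orbit g"
  have self: "x \<in> ?O x" for x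
    using permutation_self_in_orbit[of g x] fin g permutation_permutes by blast
  have fixed: "?O i = {i}" if "g i = i" for i
  proof -
    have "y = i" if "y \<in> ?O i" for y
      using that \<open>g i = i\<close> by induction auto
    then show ?thesis
      using self[of i] by blast
  qed
  have single: "g i = i" if one: "card (?O i) = 1" for i
  proof -
    obtain c where "?O i = {c}"
      using one by (auto simp: card_1_singleton_iff)
    then show ?thesis
      using self[of i] orbit.base[of g i] by simp
  qed
  have "{c \<in> ?O ` \<Omega>. card c = 1} = ?O ` {i \<in> \<Omega>. g i = i}"
  proof -
    have "card (?O i) = 1 \<longleftrightarrow> g i = i" for i
    proof
      assume "g i = i"
      then have "?O i = {i}"
        by (rule fixed)
      then show "card (?O i) = 1"
        by simp
    qed (rule single)
    then show ?thesis
      by blast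
  qed
  moreover have "inj_on ?O {i \<in> \<Omega>. g i = i}"
  proof (rule inj_onI)
    fix i j assume "i \<in> {i \<in> \<Omega>. g i = i}" "j \<in> {i \<in> \<Omega>. g i = i}" "?O i = ?O j"
    then show "i = j"
      using fixed[of i] fixed[of j] by simp
  qed
  ultimately show ?thesis
    by (simp add: num_cycles_def card_image)
qed

text \<open>Every cycle is a nonempty subset of \<open>\<Omega>\<close>, so its length lies in the
  range of summation.\<close>

lemma sum_num_cycles:
  assumes fin: "finite \<Omega>" and g: "g permutes \<Omega>"
  shows "(\<Sum>k = 1..card \<Omega>. num_cycles \<Omega> k g) = card (Orbits.orbit g ` \<Omega>)"
proof -
  let ?C = "Orbits.orbit g ` \<Omega>"
  have "card c \<in> {1..card \<Omega>}" if c: "c \<in> ?C" for c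
  proof -
    have sub: "c \<subseteq> \<Omega>"
      using c permutes_orbit_subset[OF g] by auto
    moreover have "c \<noteq> {}"
      using c orbit_nonempty[of g] by auto
    ultimately have "card c > 0"
      using fin finite_subset card_gt_0_iff by blast
    then show ?thesis
      using card_mono[OF fin sub] by simp
  qed
  then have "(\<Sum>k = 1..card \<Omega>. \<Sum>c | c \<in> ?C \<and> card c = k. 1) = (\<Sum>c\<in>?C. 1 :: nat)"
    using fin by (intro sum.group) auto
  then show ?thesis
    by (simp add: num_cycles_def)
qed

text \<open>Isolates the first variable, as needed for the partial derivative. The inequality
  ensures that \<open>m - j\<close> does not truncate.\<close>

lemma cycle_monomial:
  assumes fin: "finite \<Omega>" and g: "g permutes \<Omega>"
  defines "j \<equiv> num_cycles \<Omega> 1 g" and "m \<equiv> card (Orbits.orbit g ` \<Omega>)"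
  shows "j \<le> m"
    and "(\<Prod>k = 1..card \<Omega>. ((\<lambda>_. 2)(1 := t)) k ^ num_cycles \<Omega> k g) = (t :: real) ^ j * 2 ^ (m - j)"
proof -
  let ?s = "\<Sum>k = 2..card \<Omega>. num_cycles \<Omega> k g"
  have "j + ?s = m \<and> (\<Prod>k = 1..card \<Omega>. ((\<lambda>_. 2)(1 := t)) k ^ num_cycles \<Omega> k g) = t ^ j * 2 ^ ?s"
  \<comment> \<open>Without players the product is empty and the factor \<open>k = 1\<close> cannot
    be split off.\<close>
  proof (cases "card \<Omega> = 0")
    case True
    then have "\<Omega> = {}"
      using fin by simp
    then show ?thesis
      by (simp add: j_def m_def num_cycles_def)
  next
    case False
    then have eq: "{1..card \<Omega>} = insert 1 {2..card \<Omega>}"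
      by auto
    have "(\<Prod>k = 2..card \<Omega>. ((\<lambda>_. 2)(1 := t)) k ^ num_cycles \<Omega> k g) =
        (\<Prod>k = 2..card \<Omega>. 2 ^ num_cycles \<Omega> k g)"
      by (intro prod.cong) auto
    also have "\<dots> = 2 ^ ?s"
      by (rule power_sum[symmetric])
    finally have "(\<Prod>k = 1..card \<Omega>. ((\<lambda>_. 2)(1 := t)) k ^ num_cycles \<Omega> k g) = t ^ j * 2 ^ ?s"
      unfolding eq by (subst prod.insert) (simp_all add: j_def)
    moreover have "j + ?s = m"
      using sum_num_cycles[OF fin g] unfolding eq by (simp add: j_def m_def)
    ultimately show ?thesis
      by simp
  qed
  then have "m = j + ?s"
    "(\<Prod>k = 1..card \<Omega>. ((\<lambda>_. 2)(1 := t)) k ^ num_cycles \<Omega> k g) = t ^ j * 2 ^ ?s"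
    by simp_all
  then show "j \<le> m"
    "(\<Prod>k = 1..card \<Omega>. ((\<lambda>_. 2)(1 := t)) k ^ num_cycles \<Omega> k g) = t ^ j * 2 ^ (m - j)"
    by simp_all
qed

section \<open>Orbit counts and cycle index as sums over the group\<close>

context
  fixes \<Omega> :: "'a set" and G :: "('a \<Rightarrow> 'a) set"
  assumes fin: "finite \<Omega>" and G: "subgroup G (sym_grp \<Omega>)"
begin

lemma finite_G: "finite G"
  by (rule finite_subset[OF _ finite_permutations[OF fin]]) (use subgroup_sym_grp(1)[OF G] in blast)

lemma card_G_nonzero: "real (card G) \<noteq> 0"
  using finite_G subgroup_sym_grp(2)[OF G] by auto

lemma cycle_index_at_2:
  "card G * cycle_index \<Omega> G (\<lambda>_. 2) = (\<Sum>g\<in>G. 2 ^ card (Orbits.orbit g ` \<Omega>))"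
proof -
  have "(\<Prod>k = 1..card \<Omega>. (2::real) ^ num_cycles \<Omega> k g) = 2 ^ card (Orbits.orbit g ` \<Omega>)"
    if "g \<in> G" for g
    unfolding power_sum[symmetric] sum_num_cycles[OF fin subgroup_sym_grp(1)[OF G that]] ..
  then show ?thesis
    using card_G_nonzero by (simp add: cycle_index_def)
qed

text \<open>The monomial \<open>t ^ j * 2 ^ (m - j)\<close> has derivative
  \<open>j * 2 ^ (m - 1)\<close> at 2.\<close>

lemma partial_deriv_cycle_index_at_2:
  "card G * partial_deriv 1 (cycle_index \<Omega> G) (\<lambda>_. 2) =
    (\<Sum>g\<in>G. real (num_cycles \<Omega> 1 g) * 2 ^ card (Orbits.orbit g ` \<Omega>) / 2)"
proof -
  let ?j = "num_cycles \<Omega> 1" and ?m = "\<lambda>g. card (Orbits.orbit g ` \<Omega>)"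
  have per: "g permutes \<Omega>" if "g \<in> G" for g
    using subgroup_sym_grp(1)[OF G that] .
  have "cycle_index \<Omega> G ((\<lambda>_. 2)(1 := t)) = 1 / card G * (\<Sum>g\<in>G. t ^ ?j g * 2 ^ (?m g - ?j g))" for t
    unfolding cycle_index_def using cycle_monomial(2)[OF fin per] by simp
  moreover have "((\<lambda>t. 1 / card G * (\<Sum>g\<in>G. t ^ ?j g * 2 ^ (?m g - ?j g))) has_real_derivative
      1 / card G * (\<Sum>g\<in>G. real (?j g) * 2 ^ (?j g - 1) * 2 ^ (?m g - ?j g))) (at 2)"
    using card_G_nonzero by (auto intro!: derivative_eq_intros sum.cong)
  ultimately have "partial_deriv 1 (cycle_index \<Omega> G) (\<lambda>_. 2) =
      1 / card G * (\<Sum>g\<in>G. real (?j g) * 2 ^ (?j g - 1) * 2 ^ (?m g - ?j g))"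
    by (simp add: partial_deriv_def DERIV_imp_deriv)
  also have "(\<Sum>g\<in>G. real (?j g) * 2 ^ (?j g - 1) * 2 ^ (?m g - ?j g)) = (\<Sum>g\<in>G. real (?j g) * 2 ^ ?m g / 2)"
  proof (rule sum.cong[OF refl])
    fix g assume g: "g \<in> G"
    show "real (?j g) * 2 ^ (?j g - 1) * 2 ^ (?m g - ?j g) = real (?j g) * 2 ^ ?m g / 2"
    \<comment> \<open>For \<open>?j g = 0\<close> the exponent \<open>?j g - 1\<close> truncates,
      but the factor \<open>?j g\<close> annihilates both sides.\<close>
    proof (cases "?j g")
      case (Suc k)
      have "(2::real) ^ ?m g = 2 * (2 ^ k * 2 ^ (?m g - Suc k))"
        using cycle_monomial(1)[OF fin per[OF g]] unfolding Suc
        by (metis le_add_diff_inverse power_Suc power_add mult.assoc)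
      then show ?thesis
        unfolding Suc by (simp add: algebra_simps)
    qed simp
  qed
  finally show ?thesis
    using card_G_nonzero by simp
qed

text \<open>Burnside's lemma; each summand loses 1 because the empty invariant set is not a
  coalition.\<close>

lemma card_coalition_orbits:
  "card G * real (card (coalition_orbits \<Omega> G)) = (\<Sum>g\<in>G. 2 ^ card (Orbits.orbit g ` \<Omega>) - 1)"
proof -
  let ?act = "\<lambda>g. \<lambda>R \<in> coalitions \<Omega>. g ` R"
  interpret group_action "sym_grp \<Omega>\<lparr>carrier := G\<rparr>" "coalitions \<Omega>" ?act
    by (rule group_action_coalitions[OF G])
  have finE: "finite (coalitions \<Omega>)"
    using fin by (simp add: coalitions_def)
  have "card (coalition_orbits \<Omega> G) * card G = (\<Sum>g\<in>G. card (invariants (coalitions \<Omega>) ?act g))"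
    using burnside finE finite_G by (simp add: coalition_orbits_def order_def)
  also have "real \<dots> = (\<Sum>g\<in>G. 2 ^ card (Orbits.orbit g ` \<Omega>) - 1)"
    unfolding of_nat_sum
  proof (rule sum.cong[OF refl])
    fix g assume g: "g \<in> G"
    have "invariants (coalitions \<Omega>) ?act g = invariant_coalitions \<Omega> g - {{}}"
      by (auto simp: invariants_def coalitions_def invariant_coalitions_def)
    moreover have "{} \<in> invariant_coalitions \<Omega> g" "finite (invariant_coalitions \<Omega> g)"
      using fin by (auto simp: invariant_coalitions_def)
    ultimately show "real (card (invariants (coalitions \<Omega>) ?act g)) =
        2 ^ card (Orbits.orbit g ` \<Omega>) - 1"
      using card_invariant_coalitions[OF fin subgroup_sym_grp(1)[OF G g]]
      by (simp add: card_Diff_singleton of_nat_diff)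
  qed
  finally show ?thesis
    by (simp add: mult.commute)
qed

text \<open>Burnside's lemma. A pair is fixed iff its player is a fixed point and its coalition is
  invariant, and each fixed point lies in half of the invariant sets.\<close>

lemma card_pointed_coalition_orbits:
  "card G * real (card (pointed_coalition_orbits \<Omega> G)) =
    (\<Sum>g\<in>G. real (num_cycles \<Omega> 1 g) * 2 ^ card (Orbits.orbit g ` \<Omega>) / 2)"
proof -
  let ?act = "\<lambda>g. \<lambda>(i, R) \<in> pointed_coalitions \<Omega>. (g i, g ` R)"
  interpret group_action "sym_grp \<Omega>\<lparr>carrier := G\<rparr>" "pointed_coalitions \<Omega>" ?act
    by (rule group_action_pointed_coalitions[OF G])
  have "card (pointed_coalition_orbits \<Omega> G) * card G =
      (\<Sum>g\<in>G. card (invariants (pointed_coalitions \<Omega>) ?act g))"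
    using burnside finite_pointed_coalitions[OF fin] finite_G
    by (simp add: pointed_coalition_orbits_def order_def)
  also have "real \<dots> = (\<Sum>g\<in>G. real (num_cycles \<Omega> 1 g) * 2 ^ card (Orbits.orbit g ` \<Omega>) / 2)"
    unfolding of_nat_sum
  proof (rule sum.cong[OF refl])
    fix g assume g: "g \<in> G"
    have per: "g permutes \<Omega>"
      using subgroup_sym_grp(1)[OF G g] .
    let ?F = "{i \<in> \<Omega>. g i = i}" and ?m = "card (Orbits.orbit g ` \<Omega>)"
    have "invariants (pointed_coalitions \<Omega>) ?act g =
        (SIGMA i:?F. {R \<in> invariant_coalitions \<Omega> g. i \<in> R})"
      by (auto simp: invariants_def pointed_coalitions_def invariant_coalitions_def)
    \<comment> \<open>Doubling avoids division in the natural numbers.\<close>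
    then have "2 * card (invariants (pointed_coalitions \<Omega>) ?act g) =
        (\<Sum>i\<in>?F. 2 * card {R \<in> invariant_coalitions \<Omega> g. i \<in> R})"
      using fin by (simp add: card_SigmaI invariant_coalitions_def sum_distrib_left)
    also have "\<dots> = num_cycles \<Omega> 1 g * 2 ^ ?m"
      unfolding num_cycles_1[OF fin per]
      using card_invariant_coalitions_containing[OF fin per] by simp
    finally have "real (2 * card (invariants (pointed_coalitions \<Omega>) ?act g)) =
        real (num_cycles \<Omega> 1 g * 2 ^ ?m)"
      by (rule arg_cong)
    then show "real (card (invariants (pointed_coalitions \<Omega>) ?act g)) =
        real (num_cycles \<Omega> 1 g) * 2 ^ ?m / 2"
      by simp
  qed
  finally show ?thesis
    by (simp add: mult.commute)
qed

end

theorem theorem1: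
  fixes \<Omega> :: "'a set" and G :: "('a \<Rightarrow> 'a) set"
  assumes "finite \<Omega>" and "subgroup G (sym_grp \<Omega>)"
  shows "affine_dim (symmetric_quasi_values \<Omega> G) =
           int (card (pointed_coalition_orbits \<Omega> G)) - int (card (coalition_orbits \<Omega> G)) \<and>
         real_of_int (affine_dim (symmetric_quasi_values \<Omega> G)) =
           partial_deriv 1 (cycle_index \<Omega> G) (\<lambda>_. 2) - cycle_index \<Omega> G (\<lambda>_. 2) + 1"
proof (rule conjI)
  show dim: "affine_dim (symmetric_quasi_values \<Omega> G) =
      int (card (pointed_coalition_orbits \<Omega> G)) - int (card (coalition_orbits \<Omega> G))"
    using assms by (rule affine_dim_symmetric_quasi_values)
  note nz = card_G_nonzero[OF assms]
  have "card G * real (card (pointed_coalition_orbits \<Omega> G)) =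
      card G * partial_deriv 1 (cycle_index \<Omega> G) (\<lambda>_. 2)"
    unfolding card_pointed_coalition_orbits[OF assms] partial_deriv_cycle_index_at_2[OF assms] ..
  then have X: "real (card (pointed_coalition_orbits \<Omega> G)) =
      partial_deriv 1 (cycle_index \<Omega> G) (\<lambda>_. 2)"
    using nz by simp
  \<comment> \<open>The correction for the empty set averages to 1 over \<open>G\<close> and yields
    the final \<open>+ 1\<close> of the formula.\<close>
  have "card G * real (card (coalition_orbits \<Omega> G)) =
      card G * (cycle_index \<Omega> G (\<lambda>_. 2) - 1)"
    unfolding card_coalition_orbits[OF assms] right_diff_distrib cycle_index_at_2[OF assms]
    by (simp add: sum_subtractf)
  then have C: "real (card (coalition_orbits \<Omega> G)) = cycle_index \<Omega> G (\<lambda>_. 2) - 1"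
    using nz by simp
  show "real_of_int (affine_dim (symmetric_quasi_values \<Omega> G)) =
      partial_deriv 1 (cycle_index \<Omega> G) (\<lambda>_. 2) - cycle_index \<Omega> G (\<lambda>_. 2) + 1"
    unfolding dim using X C by simp
qed

end
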